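(* For every $\eta>0$ there is $m_0=m_0(\eta)$ such that for every integer $m\ge m_0$: with probability tending to $1$ as $n\to\infty$, the graph $G_m^n$ contains no pair of disjoint vertex sets $A,B\subset[n]$, each of cardinality at least $(1+\eta)\frac{4\log m}{m}\,n$, such that no edge of $G_m^n$ joins $A$ and $B$.
   Context: Bollobás–Riordan preferential attachment multigraph $G_m^n$. Let $w_1,\dots,w_{mn+1}$ be independent exponential random variables with mean $1$, $W_k=\sum_{i=1}^k w_i$, $W_0=0$. Put $R_k=W_k/W_{mn+1}$ for $k=1,\dots,mn$, $R_0=0$. Conditionally on $\mathbf W=\{W_k\}$, let $\ell_1,\dots,\ell_{mn}$ be independent, $\ell_k$ having density $\frac{1}{2\sqrt{R_k x}}$ on $(0,R_k]$. The vertex set of $G_m^n$ is $[n]$; vertex $j$ is identified with the interval $(R_{m(j-1)},R_{mj}]$. For each $k\in[mn]$ there is one edge joining the vertex containing $R_k$ with the vertex containing $\ell_k$ (a loop if these coincide). *)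

theory Defs
  imports "HOL-Probability.Probability" "HOL-Library.Multiset"
begin

definition br_W :: "(nat \<Rightarrow> real) \<Rightarrow> nat \<Rightarrow> real" where
  "br_W w k = (\<Sum>i=1..k. w i)"

definition br_R :: "nat \<Rightarrow> nat \<Rightarrow> (nat \<Rightarrow> real) \<Rightarrow> nat \<Rightarrow> real" where
  "br_R m n w k = br_W w k / br_W w (m * n + 1)"

definition br_weights :: "nat \<Rightarrow> nat \<Rightarrow> (nat \<Rightarrow> real) measure" where
  "br_weights m n = (\<Pi>\<^sub>M i\<in>{1..m * n + 1}. density lborel (exponential_density 1))"

definition br_endpoint_density :: "real \<Rightarrow> real \<Rightarrow> real" where
  "br_endpoint_density r x = (if 0 < x \<and> x \<le> r then 1 / (2 * sqrt (r * x)) else 0)"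

definition br_endpoints :: "nat \<Rightarrow> nat \<Rightarrow> (nat \<Rightarrow> real) \<Rightarrow> (nat \<Rightarrow> real) measure" where
  "br_endpoints m n w =
     (\<Pi>\<^sub>M k\<in>{1..m * n}. density lborel (br_endpoint_density (br_R m n w k)))"

(* Joint law of (w, l): the regular conditional law of l given w is br_endpoints m n w. *)
definition br_law :: "nat \<Rightarrow> nat \<Rightarrow> ((nat \<Rightarrow> real) \<times> (nat \<Rightarrow> real)) measure" where
  "br_law m n =
     br_weights m n \<bind> (\<lambda>w. br_endpoints m n w \<bind> (\<lambda>l.
       return ((\<Pi>\<^sub>M i\<in>{1..m * n + 1}. borel) \<Otimes>\<^sub>M (\<Pi>\<^sub>M k\<in>{1..m * n}. borel)) (w, l)))"

definition br_interval :: "nat \<Rightarrow> nat \<Rightarrow> (nat \<Rightarrow> real) \<Rightarrow> nat \<Rightarrow> real set" where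
  "br_interval m n w j = {br_R m n w (m * (j - 1)) <.. br_R m n w (m * j)}"

(* For almost every w the intervals of the vertices 1, ..., n partition (0, R_(mn)], so that
   the description is proper for all the points R_k and l_k. *)
definition br_vertex :: "nat \<Rightarrow> nat \<Rightarrow> (nat \<Rightarrow> real) \<Rightarrow> real \<Rightarrow> nat" where
  "br_vertex m n w x = (THE j. j \<in> {1..n} \<and> x \<in> br_interval m n w j)"

(* The multiset of edges, each given as its set of end vertices (a singleton for a loop). *)
definition br_edges ::
    "nat \<Rightarrow> nat \<Rightarrow> (nat \<Rightarrow> real) \<times> (nat \<Rightarrow> real) \<Rightarrow> nat set multiset" where
  "br_edges m n = (\<lambda>(w, l).
     {# {br_vertex m n w (br_R m n w k), br_vertex m n w (l k)}. k \<in># mset_set {1..m * n} #})"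

definition edge_between :: "'v set multiset \<Rightarrow> 'v set \<Rightarrow> 'v set \<Rightarrow> bool" where
  "edge_between E A B \<longleftrightarrow> (\<exists>a\<in>A. \<exists>b\<in>B. {a, b} \<in># E)"

text \<open>The conditional law is a measurable kernel, so the monadic bind above is meaningful,
  and the resulting law is a probability measure.\<close>

lemma br_W_measurable [measurable]:
  "k \<le> N \<Longrightarrow> (\<lambda>w. br_W w k) \<in> borel_measurable (\<Pi>\<^sub>M i\<in>{1..N}. borel)"
  unfolding br_W_def by (intro borel_measurable_sum measurable_component_singleton) auto

lemma br_endpoint_density_measurable [measurable]:
  "case_prod br_endpoint_density \<in> borel_measurable (borel \<Otimes>\<^sub>M borel)"
  unfolding br_endpoint_density_def by measurable

lemma br_endpoint_density_measurable' [measurable]: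
  "br_endpoint_density r \<in> borel_measurable borel"
  unfolding br_endpoint_density_def by measurable

lemma br_endpoint_density_nonneg: "0 \<le> br_endpoint_density r x"
  by (auto simp: br_endpoint_density_def)

lemma nn_integral_br_endpoint_density:
  "(\<integral>\<^sup>+x. br_endpoint_density r x \<partial>lborel) = (if 0 < r then 1 else 0)"
proof (cases "0 < r")
  case True
  have "((\<lambda>x. 1 / (2 * sqrt (r * x))) has_integral (sqrt r / sqrt r - sqrt 0 / sqrt r)) {0..r}"
  proof (rule fundamental_theorem_of_calculus_interior)
    show "continuous_on {0..r} (\<lambda>x. sqrt x / sqrt r)"
      using True by (intro continuous_intros) auto
    fix x assume "x \<in> {0<..<r}"
    then have "((\<lambda>x. sqrt x / sqrt r) has_real_derivative 1 / (2 * sqrt (r * x))) (at x)"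
      by (auto intro!: derivative_eq_intros simp: field_simps real_sqrt_mult)
    then show "((\<lambda>x. sqrt x / sqrt r) has_vector_derivative 1 / (2 * sqrt (r * x))) (at x)"
      by (simp add: has_real_derivative_iff_has_vector_derivative)
  qed (use True in auto)
  then have "((\<lambda>x. 1 / (2 * sqrt (r * x))) has_integral 1) {0..r}"
    using True by simp
  then have "((\<lambda>x. if x \<in> {0..r} then 1 / (2 * sqrt (r * x)) else 0) has_integral 1) UNIV"
    by (simp only: has_integral_restrict_UNIV)
  also have "(\<lambda>x. if x \<in> {0..r} then 1 / (2 * sqrt (r * x)) else 0) = br_endpoint_density r"
    by (auto simp: br_endpoint_density_def fun_eq_iff)
  finally have "(br_endpoint_density r has_integral 1) UNIV" .
  then have "(\<integral>\<^sup>+x. br_endpoint_density r x \<partial>lborel) = ennreal 1"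
    by (intro nn_integral_has_integral_lborel) (auto simp: br_endpoint_density_nonneg)
  with True show ?thesis by simp
next
  case False
  then have "br_endpoint_density r = (\<lambda>x. 0)"
    by (auto simp: br_endpoint_density_def fun_eq_iff)
  with False show ?thesis by simp
qed

lemma emeasure_br_endpoint:
  "emeasure (density lborel (br_endpoint_density r)) UNIV = (if 0 < r then 1 else 0)"
  by (simp add: emeasure_density nn_integral_br_endpoint_density)

lemma product_sigma_finite_br_endpoints:
  "product_sigma_finite (\<lambda>k. density lborel (br_endpoint_density (br_R m n w k)))"
proof
  fix k
  interpret finite_measure "density lborel (br_endpoint_density (br_R m n w k))"
    by standard (simp add: emeasure_br_endpoint)
  show "\<exists>A. countable A \<and> A \<subseteq> sets (density lborel (br_endpoint_density (br_R m n w k))) \<and>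
      \<Union> A = space (density lborel (br_endpoint_density (br_R m n w k))) \<and>
      (\<forall>a\<in>A. emeasure (density lborel (br_endpoint_density (br_R m n w k))) a \<noteq> \<infinity>)"
    by (rule sigma_finite_countable)
qed

lemma emeasure_br_endpoints:
  assumes "\<And>k. k \<in> {1..m * n} \<Longrightarrow> E k \<in> sets borel"
  shows "emeasure (br_endpoints m n w) (Pi\<^sub>E {1..m * n} E) =
    (\<Prod>k\<in>{1..m * n}. emeasure (density lborel (br_endpoint_density (br_R m n w k))) (E k))"
  unfolding br_endpoints_def using assms
  by (intro product_sigma_finite.emeasure_PiM[OF product_sigma_finite_br_endpoints]) auto

lemma sets_br_endpoints [measurable_cong]:
  "sets (br_endpoints m n w) = sets (\<Pi>\<^sub>M k\<in>{1..m * n}. borel)"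
  unfolding br_endpoints_def by (intro sets_PiM_cong) auto

lemma space_br_endpoints: "space (br_endpoints m n w) = (\<Pi>\<^sub>E k\<in>{1..m * n}. UNIV)"
  unfolding br_endpoints_def by (simp add: space_PiM)

lemma sets_br_weights [measurable_cong]:
  "sets (br_weights m n) = sets (\<Pi>\<^sub>M i\<in>{1..m * n + 1}. borel)"
  unfolding br_weights_def by (intro sets_PiM_cong) auto

lemma subprob_space_br_endpoints: "subprob_space (br_endpoints m n w)"
proof
  have "emeasure (br_endpoints m n w) (\<Pi>\<^sub>E k\<in>{1..m * n}. UNIV) \<le> 1"
    by (subst emeasure_br_endpoints) (auto simp: emeasure_br_endpoint intro!: prod_le_1)
  then show "emeasure (br_endpoints m n w) (space (br_endpoints m n w)) \<le> 1"
    by (simp add: space_br_endpoints)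
  show "space (br_endpoints m n w) \<noteq> {}"
    by (simp add: space_br_endpoints PiE_eq_empty_iff)
qed

lemma br_endpoints_measurable [measurable]:
  "br_endpoints m n \<in> br_weights m n \<rightarrow>\<^sub>M subprob_algebra (\<Pi>\<^sub>M k\<in>{1..m * n}. borel)"
proof (rule measurable_subprob_algebra_generated[OF sets_PiM Int_stable_prod_algebra
      prod_algebra_sets_into_space subprob_space_br_endpoints sets_br_endpoints])
  have emeas: "(\<lambda>w. emeasure (br_endpoints m n w) (Pi\<^sub>E {1..m * n} E)) \<in> borel_measurable (br_weights m n)"
    if E: "\<And>k. k \<in> {1..m * n} \<Longrightarrow> E k \<in> sets borel" for E :: "nat \<Rightarrow> real set"
  proof (subst emeasure_br_endpoints[OF E], assumption, intro borel_measurable_prod_ennreal)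
    fix k assume k: "k \<in> {1..m * n}"
    have [measurable]: "E k \<in> sets borel" by (rule E[OF k])
    have "(\<lambda>w. br_R m n w k) \<in> borel_measurable (\<Pi>\<^sub>M i\<in>{1..m * n + 1}. borel)"
      unfolding br_R_def using k by (intro borel_measurable_divide br_W_measurable) auto
    then have [measurable]: "(\<lambda>w. br_R m n w k) \<in> borel_measurable (br_weights m n)"
      by (simp cong: measurable_cong_sets add: sets_br_weights)
    show "(\<lambda>w. emeasure (density lborel (br_endpoint_density (br_R m n w k))) (E k))
        \<in> borel_measurable (br_weights m n)"
      by (simp add: emeasure_density)
  qed
  show "(\<lambda>w. emeasure (br_endpoints m n w) (\<Pi>\<^sub>E k\<in>{1..m * n}. space borel))
      \<in> borel_measurable (br_weights m n)"
    by (rule emeas) auto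
  fix A assume "A \<in> prod_algebra {1..m * n} (\<lambda>k. borel :: real measure)"
  then obtain E where "A = Pi\<^sub>E {1..m * n} E" "E \<in> {1..m * n} \<rightarrow> sets borel"
    by (rule prod_algebraE_all) auto
  then show "(\<lambda>w. emeasure (br_endpoints m n w) A) \<in> borel_measurable (br_weights m n)"
    using emeas[of E] by (simp add: Pi_iff)
qed

lemma prob_space_br_weights: "prob_space (br_weights m n)"
  unfolding br_weights_def
  by (intro prob_space_PiM prob_space_exponential_density) auto

lemma AE_br_weights_pos: "AE w in br_weights m n. \<forall>i\<in>{1..m * n + 1}. 0 < w i"
proof -
  have "AE x in density lborel (exponential_density 1). 0 < x"
    using AE_lborel_singleton[of "0::real"]
    by (subst AE_density) (auto simp: exponential_density_def)
  then have "AE w in br_weights m n. 0 < w i" if "i \<in> {1..m * n + 1}" for i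
    unfolding br_weights_def
    by (intro AE_PiM_component[OF prob_space_exponential_density that]) auto
  then show ?thesis by (intro AE_finite_allI) auto
qed

lemma prob_space_br_law: "prob_space (br_law m n)"
proof -
  let ?N = "(\<Pi>\<^sub>M i\<in>{1..m * n + 1}. borel :: real measure) \<Otimes>\<^sub>M (\<Pi>\<^sub>M k\<in>{1..m * n}. borel :: real measure)"
  interpret prob_space "br_weights m n" by (rule prob_space_br_weights)
  have pair: "(\<lambda>l. return ?N (w, l)) \<in> (\<Pi>\<^sub>M k\<in>{1..m * n}. borel) \<rightarrow>\<^sub>M subprob_algebra ?N"
    if "w \<in> space (br_weights m n)" for w
    using that sets_eq_imp_space_eq[OF sets_br_weights[of m n]]
    by (intro measurable_compose[OF measurable_Pair return_measurable]) auto
  have prob: "prob_space (br_endpoints m n w \<bind> (\<lambda>l. return ?N (w, l)))"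
    if w: "w \<in> space (br_weights m n)" and pos: "\<forall>i\<in>{1..m * n + 1}. 0 < w i" for w
  proof -
    have "0 < br_R m n w k" if "k \<in> {1..m * n}" for k
      unfolding br_R_def br_W_def using pos that
      by (intro divide_pos_pos sum_pos) auto
    then have "emeasure (br_endpoints m n w) (\<Pi>\<^sub>E k\<in>{1..m * n}. UNIV) = 1"
      by (subst emeasure_br_endpoints) (auto simp: emeasure_br_endpoint intro!: prod.neutral)
    then interpret E: prob_space "br_endpoints m n w"
      by (intro prob_spaceI) (simp add: space_br_endpoints)
    show ?thesis
    proof (rule E.prob_space_bind)
      show "AE l in br_endpoints m n w. prob_space (return ?N (w, l))"
        using w sets_eq_imp_space_eq[OF sets_br_weights[of m n]]
        by (intro AE_I2 prob_space_return)
           (auto simp: space_pair_measure space_br_endpoints space_PiM)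
      show "(\<lambda>l. return ?N (w, l)) \<in> br_endpoints m n w \<rightarrow>\<^sub>M subprob_algebra ?N"
        using pair[OF w] by (simp cong: measurable_cong_sets add: sets_br_endpoints)
    qed
  qed
  show ?thesis
    unfolding br_law_def
  proof (rule prob_space_bind)
    show "AE w in br_weights m n. prob_space (br_endpoints m n w \<bind> (\<lambda>l. return ?N (w, l)))"
      using AE_br_weights_pos AE_space by eventually_elim (rule prob)
    show "(\<lambda>w. br_endpoints m n w \<bind> (\<lambda>l. return ?N (w, l)))
        \<in> br_weights m n \<rightarrow>\<^sub>M subprob_algebra ?N"
    proof (rule measurable_bind[OF br_endpoints_measurable])
      have "(\<lambda>x. x) \<in> br_weights m n \<Otimes>\<^sub>M (\<Pi>\<^sub>M k\<in>{1..m * n}. borel) \<rightarrow>\<^sub>M ?N"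
        by (intro measurable_ident_sets sets_pair_measure_cong sets_br_weights refl)
      then show "(\<lambda>x. return ?N (fst x, snd x))
          \<in> br_weights m n \<Otimes>\<^sub>M (\<Pi>\<^sub>M k\<in>{1..m * n}. borel) \<rightarrow>\<^sub>M subprob_algebra ?N"
        by (simp add: measurable_compose[OF _ return_measurable])
    qed
  qed
qed

end

theory Submission
  imports Defs
begin

text \<open>Let \<open>s = \<lceil>(1 + \<eta>) (4 ln m / m) n\<rceil>\<close>. Since \<open>R\<^sub>k \<le> 1\<close>, the density of \<open>\<ell>\<^sub>k\<close> is at least \<open>1/2\<close> on
  \<open>(0, R\<^sub>k]\<close>, so each of the \<open>m\<close> edges of a vertex \<open>j\<close> hits an earlier vertex \<open>i\<close> with conditional
  probability at least half the length of the interval of \<open>i\<close>. By Chernoff bounds for sums of the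
  exponential weights, with high probability all but \<open>\<epsilon> s\<close> of the intervals have length at least
  \<open>(1 - \<epsilon>) / ((1 + \<epsilon>) n)\<close>. Hence two given disjoint \<open>s\<close>-sets span no edge with conditional
  probability at most about \<open>exp (- m s\<^sup>2 / (2 n)) \<le> exp (- 2 (1 + \<eta>) s ln m)\<close>, which beats the number
  \<open>(n choose s)\<^sup>2 \<le> exp (2 s ln m)\<close> of pairs.\<close>

section \<open>Chernoff bounds for the weights\<close>

lemma nn_integral_exp_exponential:
  fixes t :: real
  assumes "-1 < t"
  shows "(\<integral>\<^sup>+x. ennreal (exp (- t * x)) \<partial>density lborel (exponential_density 1)) = ennreal (1 / (1 + t))"
proof -
  have eq: "exponential_density 1 x * exp (- t * x) = 1 / (1 + t) * exponential_density (1 + t) x" for x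
  proof -
    have "exp (- x) * exp (- t * x) = exp (- x * (1 + t))"
      by (simp add: mult_exp_exp algebra_simps)
    then show ?thesis using assms by (auto simp: exponential_density_def)
  qed
  have one: "(\<integral>\<^sup>+x. ennreal (exponential_density (1 + t) x) \<partial>lborel) = 1"
    using prob_space.emeasure_space_1[OF prob_space_exponential_density[of "1 + t"]] assms
    by (simp add: emeasure_density)
  have "(\<integral>\<^sup>+x. ennreal (exp (- t * x)) \<partial>density lborel (exponential_density 1)) =
      (\<integral>\<^sup>+x. ennreal (exponential_density 1 x * exp (- t * x)) \<partial>lborel)"
    by (subst nn_integral_density) (auto simp: ennreal_mult'' )
  also have "\<dots> = (\<integral>\<^sup>+x. ennreal (1 / (1 + t)) * ennreal (exponential_density (1 + t) x) \<partial>lborel)"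
    using assms by (subst eq, subst ennreal_mult') auto
  also have "\<dots> = ennreal (1 / (1 + t))"
    by (subst nn_integral_cmult) (auto simp: one)
  finally show ?thesis .
qed

lemma br_weights_sum_measurable [measurable]:
  assumes "I \<subseteq> {1..m * n + 1}"
  shows "(\<lambda>w. \<Sum>i\<in>I. w i) \<in> borel_measurable (br_weights m n)"
  using assms unfolding br_weights_def
  by (intro borel_measurable_sum) (auto intro!: measurable_compose[OF measurable_component_singleton])

text \<open>Exponential Markov inequality combined with independence of the weights. Keeping
  \<open>t\<close> on both sides of the event covers both tails at once: positive \<open>t\<close>
  gives the lower tail, negative \<open>t\<close> the upper one.\<close>

lemma br_weights_chernoff:
  fixes t c :: real
  assumes "-1 < t" and I: "I \<subseteq> {1..m * n + 1}"
  shows "emeasure (br_weights m n) {w \<in> space (br_weights m n). t * (\<Sum>i\<in>I. w i) \<le> t * c}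
    \<le> ennreal (exp (t * c) / (1 + t) ^ card I)"
proof -
  let ?J = "{1..m * n + 1}"
  let ?E = "density lborel (exponential_density 1) :: real measure"
  \<comment> \<open>Indices outside \<open>I\<close> get the factor 1, so that the product runs over
    the full index set and integrates factor by factor.\<close>
  let ?f = "\<lambda>i x. ennreal (if i \<in> I then exp (- t * x) else 1)"
  interpret product_sigma_finite "\<lambda>_. ?E"
    by (intro product_sigma_finite.intro prob_space_imp_sigma_finite prob_space_exponential_density) auto
  interpret E: prob_space ?E by (rule prob_space_exponential_density) auto
  have fin: "finite I" using I by (rule finite_subset) auto
  note br_weights_sum_measurable[OF I, measurable]
  have "emeasure (br_weights m n) {w \<in> space (br_weights m n). t * (\<Sum>i\<in>I. w i) \<le> t * c}
      = (\<integral>\<^sup>+w. indicator {w \<in> space (br_weights m n). t * (\<Sum>i\<in>I. w i) \<le> t * c} w \<partial>br_weights m n)"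
    by (subst nn_integral_indicator) auto
  also have "\<dots> \<le> (\<integral>\<^sup>+w. ennreal (exp (t * c)) * (\<Prod>i\<in>?J. ?f i (w i)) \<partial>br_weights m n)"
  proof (intro nn_integral_mono)
    fix w
    have "(\<Prod>i\<in>?J. if i \<in> I then exp (- t * w i) else 1) = (\<Prod>i\<in>I. exp (- t * w i))"
      using I by (intro prod.mono_neutral_cong_right) auto
    also have "\<dots> = exp (- t * (\<Sum>i\<in>I. w i))"
      using fin by (simp add: exp_sum[symmetric] sum_distrib_left sum_negf)
    finally have "(\<Prod>i\<in>?J. ?f i (w i)) = ennreal (exp (- t * (\<Sum>i\<in>I. w i)))"
      by (subst prod_ennreal) auto
    then have "ennreal (exp (t * c)) * (\<Prod>i\<in>?J. ?f i (w i)) = ennreal (exp (t * c - t * (\<Sum>i\<in>I. w i)))"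
      by (simp add: ennreal_mult''[symmetric] exp_add[symmetric])
    then show "indicator {w \<in> space (br_weights m n). t * (\<Sum>i\<in>I. w i) \<le> t * c} w
        \<le> ennreal (exp (t * c)) * (\<Prod>i\<in>?J. ?f i (w i))"
      by (auto simp: indicator_def simp flip: ennreal_1 intro!: ennreal_leI)
  qed
  also have "\<dots> = ennreal (exp (t * c)) * (\<integral>\<^sup>+w. (\<Prod>i\<in>?J. ?f i (w i)) \<partial>br_weights m n)"
    unfolding br_weights_def
    by (intro nn_integral_cmult borel_measurable_prod_ennreal
        measurable_compose[OF measurable_component_singleton]) auto
  also have "(\<integral>\<^sup>+w. (\<Prod>i\<in>?J. ?f i (w i)) \<partial>br_weights m n) = (\<Prod>i\<in>?J. (\<integral>\<^sup>+x. ?f i x \<partial>?E))"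
    unfolding br_weights_def by (intro product_nn_integral_prod) auto
  also have "\<dots> = (\<Prod>i\<in>?J. if i \<in> I then ennreal (1 / (1 + t)) else 1)"
    using E.emeasure_space_1 nn_integral_exp_exponential[OF assms(1)] by (intro prod.cong) auto
  also have "\<dots> = (\<Prod>i\<in>I. ennreal (1 / (1 + t)))"
    using I by (intro prod.mono_neutral_cong_right) auto
  also have "ennreal (exp (t * c)) * \<dots> = ennreal (exp (t * c) / (1 + t) ^ card I)"
    using assms by (simp add: ennreal_power ennreal_mult'[symmetric] power_divide)
  finally show ?thesis .
qed

section \<open>Edges between two vertex sets for fixed weights\<close>

text \<open>For \<open>x\<close> in \<open>S\<close> both \<open>x\<close> and \<open>r\<close> are
  at most 1, so the density is at least 1/2 there, and \<open>1 - y \<le> exp (- y)\<close> turns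
  the complement into an exponential.\<close>

lemma emeasure_br_endpoint_Compl_le:
  assumes r: "0 < r" "r \<le> 1" and S: "S \<in> sets borel" "S \<subseteq> {0<..r}"
  shows "emeasure (density lborel (br_endpoint_density r)) (- S) \<le> ennreal (exp (- measure lborel S / 2))"
proof -
  let ?D = "density lborel (br_endpoint_density r)"
  interpret D: prob_space ?D
    using r by (intro prob_spaceI) (simp add: emeasure_br_endpoint)
  have [measurable]: "S \<in> sets borel" by fact
  have "emeasure lborel S \<le> emeasure lborel {0<..r}" using S by (intro emeasure_mono) auto
  then have fin: "emeasure lborel S \<noteq> \<infinity>" using r by (auto simp: top_unique)
  have "ennreal (measure lborel S / 2) = ennreal (1 / 2) * ennreal (measure lborel S)"
    by (subst ennreal_mult[symmetric]) auto
  also have "\<dots> = (\<integral>\<^sup>+x. ennreal (1 / 2) * indicator S x \<partial>lborel)"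
    using fin by (subst nn_integral_cmult_indicator) (auto simp: emeasure_eq_ennreal_measure)
  also have "\<dots> \<le> (\<integral>\<^sup>+x. ennreal (br_endpoint_density r x) * indicator S x \<partial>lborel)"
  proof (intro nn_integral_mono)
    fix x
    have "1 / 2 \<le> br_endpoint_density r x" if "x \<in> S"
    proof -
      have x: "0 < x" "x \<le> r" using S that by auto
      then have "r * x \<le> 1" using r mult_mono[of r 1 x 1] by auto
      then have "sqrt (r * x) \<le> 1" by simp
      then show ?thesis
        using x r by (simp add: br_endpoint_density_def field_simps)
    qed
    then show "ennreal (1 / 2) * indicator S x \<le> ennreal (br_endpoint_density r x) * indicator S x"
      using ennreal_leI[of "1 / 2" "br_endpoint_density r x"]
      by (cases "x \<in> S") (simp_all del: ennreal_half)
  qed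
  also have "\<dots> = ennreal (D.prob S)"
    by (simp add: D.emeasure_eq_measure[symmetric] emeasure_density)
  finally have "measure lborel S / 2 \<le> D.prob S" by simp
  moreover have "D.prob (- S) = 1 - D.prob S"
    using D.prob_compl[of S] by (simp add: Compl_eq_Diff_UNIV)
  moreover have "1 + - measure lborel S / 2 \<le> exp (- measure lborel S / 2)"
    by (rule exp_ge_add_one_self)
  ultimately have "D.prob (- S) \<le> exp (- measure lborel S / 2)" by linarith
  then show ?thesis by (simp add: D.emeasure_eq_measure ennreal_leI)
qed

text \<open>The length of the interval of vertex \<open>j\<close> before division by the common
  random factor \<open>br_W w (m * n + 1)\<close>. Without that factor, distinct blocks depend on
  disjoint sets of independent weights.\<close>

definition br_block :: "nat \<Rightarrow> (nat \<Rightarrow> real) \<Rightarrow> nat \<Rightarrow> real" where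
  "br_block m w j = br_W w (m * j) - br_W w (m * (j - 1))"

lemma br_block_eq_sum: "0 < j \<Longrightarrow> br_block m w j = (\<Sum>k\<in>{m * (j - 1)<..m * j}. w k)"
proof -
  assume j: "0 < j"
  have "{1..m * j} = {1..m * (j - 1)} \<union> {m * (j - 1)<..m * j}"
  proof -
    have "m * (j - 1) \<le> m * j" by (intro mult_le_mono2) auto
    then show ?thesis unfolding set_eq_iff Un_iff atLeastAtMost_iff greaterThanAtMost_iff by linarith
  qed
  then have "br_W w (m * j) = br_W w (m * (j - 1)) + (\<Sum>k\<in>{m * (j - 1)<..m * j}. w k)"
    unfolding br_W_def by (subst sum.union_disjoint[symmetric]) (auto intro!: arg_cong[where f="sum w"])
  then show ?thesis by (simp add: br_block_def)
qed

section \<open>Order of the points and location of the vertices\<close>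

lemma br_W_strict_mono:
  assumes pos: "\<forall>i\<in>{1..N}. 0 < w i" and "k < k'" "k' \<le> N"
  shows "br_W w k < br_W w k'"
proof -
  have "br_W w k' = br_W w k + (\<Sum>i\<in>{k<..k'}. w i)"
  proof -
    have "{1..k'} = {1..k} \<union> {k<..k'}" using assms by auto
    then show ?thesis unfolding br_W_def
      by (subst sum.union_disjoint[symmetric]) auto
  qed
  moreover have "0 < (\<Sum>i\<in>{k<..k'}. w i)" using assms by (intro sum_pos) auto
  ultimately show ?thesis by simp
qed

lemma br_W_mono:
  assumes pos: "\<forall>i\<in>{1..N}. 0 < w i" and "k \<le> k'" "k' \<le> N"
  shows "br_W w k \<le> br_W w k'"
  using br_W_strict_mono[OF pos, of k k'] assms by (cases "k = k'") auto

lemma br_W_total_pos: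
  assumes "\<forall>i\<in>{1..m * n + 1}. 0 < w i"
  shows "0 < br_W w (m * n + 1)"
  using br_W_strict_mono[OF assms, of 0 "m * n + 1"] by (simp add: br_W_def)

lemma br_R_mono:
  assumes pos: "\<forall>i\<in>{1..m * n + 1}. 0 < w i" and "k \<le> k'" "k' \<le> m * n"
  shows "br_R m n w k \<le> br_R m n w k'"
  using br_W_mono[OF pos, of k k'] br_W_total_pos[OF pos] assms
  by (auto simp: br_R_def divide_right_mono)

lemma br_R_strict_mono:
  assumes pos: "\<forall>i\<in>{1..m * n + 1}. 0 < w i" and "k < k'" "k' \<le> m * n"
  shows "br_R m n w k < br_R m n w k'"
  using br_W_strict_mono[OF pos, of k k'] br_W_total_pos[OF pos] assms
  by (auto simp: br_R_def divide_strict_right_mono)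

lemma br_R_bounds:
  assumes pos: "\<forall>i\<in>{1..m * n + 1}. 0 < w i" and "k \<in> {1..m * n}"
  shows "0 < br_R m n w k" "br_R m n w k \<le> 1"
proof -
  have "br_R m n w 0 < br_R m n w k" using assms by (intro br_R_strict_mono) auto
  then show "0 < br_R m n w k" by (simp add: br_R_def br_W_def)
  show "br_R m n w k \<le> 1"
    using br_W_mono[OF pos, of k "m * n + 1"] br_W_total_pos[OF pos] assms by (simp add: br_R_def)
qed

lemma br_interval_disjoint:
  assumes pos: "\<forall>i\<in>{1..m * n + 1}. 0 < w i" and ij: "i \<in> {1..n}" "j \<in> {1..n}" "i \<noteq> j"
  shows "br_interval m n w i \<inter> br_interval m n w j = {}"
proof -
  have *: "br_R m n w (m * i) \<le> br_R m n w (m * (j - 1))" if "i < j" "j \<in> {1..n}" for i j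
    using that by (intro br_R_mono[OF pos]) auto
  from ij(3) consider "i < j" | "j < i" by linarith
  then show ?thesis
  proof cases
    case 1 then show ?thesis using *[of i j] ij by (auto simp: br_interval_def)
  next
    case 2 then show ?thesis using *[of j i] ij by (auto simp: br_interval_def)
  qed
qed

text \<open>Disjointness of the intervals makes the description in \<open>br_vertex\<close>
  unique.\<close>

lemma br_vertex_eq:
  assumes pos: "\<forall>i\<in>{1..m * n + 1}. 0 < w i" and "j \<in> {1..n}" "x \<in> br_interval m n w j"
  shows "br_vertex m n w x = j"
  unfolding br_vertex_def
proof (rule the_equality)
  fix i assume "i \<in> {1..n} \<and> x \<in> br_interval m n w i"
  then show "i = j" using br_interval_disjoint[OF pos, of i j] assms by auto
qed (use assms in auto)

text \<open>Strict growth of \<open>br_R m n w\<close> carries the half-open block of indices into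
  the half-open interval of the same vertex.\<close>

lemma br_vertex_br_R:
  assumes pos: "\<forall>i\<in>{1..m * n + 1}. 0 < w i" and j: "j \<in> {1..n}" and k: "k \<in> {m * (j - 1)<..m * j}"
  shows "br_vertex m n w (br_R m n w k) = j"
proof (rule br_vertex_eq[OF pos j])
  have "m * j \<le> m * n" using j by auto
  moreover from this k have "k \<le> m * n" by (metis greaterThanAtMost_iff le_trans)
  ultimately show "br_R m n w k \<in> br_interval m n w j"
    using j k br_R_strict_mono[OF pos, of "m * (j - 1)" k] br_R_mono[OF pos, of k "m * j"]
    by (auto simp: br_interval_def)
qed

section \<open>Blocks of edge indices and counting of pairs\<close>

lemma sum_blocks:
  fixes f :: "nat \<Rightarrow> 'a :: comm_monoid_add"
  shows "(\<Sum>k=1..m * n. f k) = (\<Sum>j=1..n. \<Sum>k\<in>{m * (j - 1)<..m * j}. f k)"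
proof (induction n)
  case (Suc n)
  have un: "{1..m * Suc n} = {1..m * n} \<union> {m * n<..m * Suc n}" by auto
  have "(\<Sum>k=1..m * Suc n. f k) = (\<Sum>k=1..m * n. f k) + (\<Sum>k\<in>{m * n<..m * Suc n}. f k)"
    unfolding un by (rule sum.union_disjoint) auto
  with Suc show ?case by simp
qed auto

text \<open>Indices start at 1, so after subtracting 1 the block of \<open>j\<close> becomes the
  range from \<open>m * (j - 1)\<close> to \<open>m * j - 1\<close>, on which division by
  \<open>m\<close> is constant.\<close>

lemma block_index:
  assumes "k \<in> {m * (j - 1)<..m * j}" "0 < j"
  shows "(k - 1) div m + 1 = (j::nat)"
proof -
  obtain i where j: "j = Suc i" using assms by (cases j) auto
  have "(k - 1) div m = i"
    by (rule div_nat_eqI) (use assms j in \<open>auto simp: mult.commute\<close>)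
  then show ?thesis using j by simp
qed

text \<open>Only the edges of the later vertex of a pair can reach the earlier one, so each pair in
  \<open>A \<times> B\<close> is counted at its larger element.\<close>

lemma card_times_le_sum_smaller:
  fixes A B :: "nat set"
  assumes "A \<subseteq> {1..n}" "B \<subseteq> {1..n}" "A \<inter> B = {}"
  shows "card A * card B \<le> (\<Sum>j=1..n. card {i. i < j \<and> (j \<in> A \<and> i \<in> B \<or> j \<in> B \<and> i \<in> A)})"
proof -
  let ?C = "\<lambda>j. {i. i < j \<and> (j \<in> A \<and> i \<in> B \<or> j \<in> B \<and> i \<in> A)}"
  have "card (A \<times> B) \<le> card (Sigma {1..n} ?C)"
  proof (rule card_inj_on_le[where f = "\<lambda>(a, b). (max a b, min a b)"])
    show "inj_on (\<lambda>(a, b). (max a b, min a b)) (A \<times> B)"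
    proof (rule inj_onI, clarsimp)
      fix a b a' b' assume "a \<in> A" "b \<in> B" "a' \<in> A" "b' \<in> B"
        and "max a b = max a' b'" "min a b = min a' b'"
      \<comment> \<open>Maximum and minimum determine only the unordered pair; the swapped case
        would put \<open>a\<close> into both \<open>A\<close> and \<open>B\<close>.\<close>
      then have "a = a' \<and> b = b' \<or> a = b' \<and> b = a'"
        by (auto simp: max_def min_def split: if_splits)
      then show "a = a' \<and> b = b'" using assms(3) \<open>a \<in> A\<close> \<open>b' \<in> B\<close> by blast
    qed
    show "(\<lambda>(a, b). (max a b, min a b)) ` (A \<times> B) \<subseteq> Sigma {1..n} ?C"
    proof (intro image_subsetI, unfold split_beta, intro SigmaI)
      fix p assume p: "p \<in> A \<times> B"
      define a b where "a = fst p" and "b = snd p"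
      have ab: "a \<in> A" "b \<in> B" using p by (auto simp: a_def b_def)
      then have "a \<noteq> b" using assms(3) by auto
      with ab show "min (fst p) (snd p) \<in> ?C (max (fst p) (snd p))"
        by (auto simp: max_def min_def a_def b_def)
      show "max (fst p) (snd p) \<in> {1..n}" using ab assms by (auto simp: max_def a_def b_def)
    qed
  qed auto
  also have "\<dots> = (\<Sum>j=1..n. card (?C j))" by (rule card_SigmaI) auto
  finally show ?thesis by (simp add: card_cartesian_product)
qed

text \<open>Additivity over disjoint intervals, each having as its length a difference of two values
  of \<open>br_R m n w\<close>. This isolates the total weight as a single denominator.\<close>

lemma measure_Union_br_interval:
  assumes pos: "\<forall>i\<in>{1..m * n + 1}. 0 < w i" and C: "C \<subseteq> {1..n}"
  shows "measure lborel (\<Union>i\<in>C. br_interval m n w i) = (\<Sum>i\<in>C. br_block m w i) / br_W w (m * n + 1)"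
proof -
  have fin: "finite C" using C by (rule finite_subset) auto
  have le: "br_R m n w (m * (i - 1)) \<le> br_R m n w (m * i)" if "i \<in> C" for i
    using C that by (intro br_R_mono[OF pos]) auto
  have "measure lborel (\<Union>i\<in>C. br_interval m n w i) = (\<Sum>i\<in>C. measure lborel (br_interval m n w i))"
  proof (rule measure_finite_Union[OF fin])
    show "disjoint_family_on (br_interval m n w) C"
      unfolding disjoint_family_on_def
      by (intro ballI impI br_interval_disjoint[OF pos]) (use C in blast)+
  qed (use le in \<open>auto simp: br_interval_def\<close>)
  also have "\<dots> = (\<Sum>i\<in>C. br_block m w i / br_W w (m * n + 1))"
  proof (intro sum.cong refl)
    fix i assume "i \<in> C"
    then have "measure lborel (br_interval m n w i) = br_R m n w (m * i) - br_R m n w (m * (i - 1))"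
      unfolding br_interval_def using le by (intro measure_lborel_Ioc)
    then show "measure lborel (br_interval m n w i) = br_block m w i / br_W w (m * n + 1)"
      by (simp add: br_block_def br_R_def diff_divide_distrib)
  qed
  finally show ?thesis by (simp add: sum_divide_distrib)
qed

lemma edge_between_br_edges_iff:
  "edge_between (br_edges m n (w, l)) A B \<longleftrightarrow>
    (\<exists>k\<in>{1..m * n}. \<exists>a\<in>A. \<exists>b\<in>B. {br_vertex m n w (br_R m n w k), br_vertex m n w (l k)} = {a, b})"
  by (auto simp: edge_between_def br_edges_def)

text \<open>Given the weights, the endpoints are independent. If no edge joins \<open>A\<close> and
  \<open>B\<close>, each \<open>l k\<close> avoids the region \<open>U k\<close> in which it would
  create such an edge to an earlier vertex. The avoidance bounds multiply, so only the total length
  of the regions matters.\<close>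

lemma emeasure_no_edge_le:
  assumes m: "0 < m" and pos: "\<forall>i\<in>{1..m * n + 1}. 0 < w i"
    and AB: "A \<subseteq> {1..n}" "B \<subseteq> {1..n}" "A \<inter> B = {}"
    and x: "\<And>i. i \<in> A \<union> B \<Longrightarrow> x \<le> br_block m w i"
  shows "emeasure (br_endpoints m n w)
      {l \<in> space (br_endpoints m n w). \<not> edge_between (br_edges m n (w, l)) A B}
    \<le> ennreal (exp (- (real m * x * real (card A) * real (card B) / (2 * br_W w (m * n + 1)))))"
proof (cases "0 \<le> x")
  case True
  let ?W = "br_W w (m * n + 1)"
  have W: "0 < ?W" by (rule br_W_total_pos[OF pos])
  \<comment> \<open>\<open>C j\<close> holds the vertices before \<open>j\<close> on the side
    opposite to \<open>j\<close>; it is empty unless \<open>j\<close> lies in \<open>A\<close> or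
    \<open>B\<close>.\<close>
  define C where "C j = {i. i < j \<and> (j \<in> A \<and> i \<in> B \<or> j \<in> B \<and> i \<in> A)}" for j
  \<comment> \<open>The vertex owning index \<open>k\<close>, from which edge \<open>k\<close> is
    drawn.\<close>
  define J where "J k = (k - 1) div m + 1" for k
  define U where "U k = (\<Union>i\<in>C (J k). br_interval m n w i)" for k
  have CAB: "C j \<subseteq> A \<union> B" "C j \<subseteq> {1..n}" for j using AB by (auto simp: C_def)
  have fin: "finite (C j)" for j using CAB(2) by (rule finite_subset) auto
  have U: "U k \<in> sets borel" for k
    unfolding U_def using fin by (auto simp: br_interval_def)
  have J: "J k \<in> {1..n}" "k \<in> {m * (J k - 1)<..m * J k}" if "k \<in> {1..m * n}" for k
  proof -
    have "k - 1 < m * n" using that by auto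
    then have "(k - 1) div m < n" using m by (simp add: less_mult_imp_div_less mult.commute)
    then show "J k \<in> {1..n}" by (simp add: J_def)
    have "m * ((k - 1) div m) \<le> k - 1" by simp
    moreover have "k - 1 < m * ((k - 1) div m) + m" using dividend_less_times_div[OF m, of "k - 1"] by simp
    moreover have "0 < k" using that by auto
    ultimately have "m * ((k - 1) div m) < k" "k \<le> m * ((k - 1) div m) + m" by linarith+
    then show "k \<in> {m * (J k - 1)<..m * J k}" by (simp add: J_def)
  qed
  \<comment> \<open>Since \<open>C\<close> admits earlier vertices only, their intervals end at or
    below \<open>br_R m n w k\<close>, inside the range where the density bound holds.\<close>
  have UR: "U k \<subseteq> {0<..br_R m n w k}" if k: "k \<in> {1..m * n}" for k
  proof
    fix y assume "y \<in> U k"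
    then obtain i where i: "i \<in> C (J k)" "y \<in> br_interval m n w i" by (auto simp: U_def)
    have "i < J k" using i by (auto simp: C_def)
    then have "m * i \<le> m * (J k - 1)" by auto
    also have "\<dots> \<le> k" using J(2)[OF k] by auto
    finally have "br_R m n w (m * i) \<le> br_R m n w k"
      using k by (intro br_R_mono[OF pos]) auto
    moreover have "m * (i - 1) \<le> m * n" using CAB(2) i(1) by (intro mult_le_mono2) force
    then have "br_R m n w 0 \<le> br_R m n w (m * (i - 1))" by (intro br_R_mono[OF pos]) auto
    ultimately show "y \<in> {0<..br_R m n w k}" using i by (auto simp: br_interval_def br_R_def br_W_def)
  qed
  have meas: "real (card (C (J k))) * x / ?W \<le> measure lborel (U k)" for k
  proof -
    have "real (card (C (J k))) * x \<le> (\<Sum>i\<in>C (J k). br_block m w i)"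
      using CAB(1) x by (intro sum_bounded_below) auto
    then show ?thesis
      unfolding U_def measure_Union_br_interval[OF pos CAB(2)] using W by (intro divide_right_mono) auto
  qed
  have "{l \<in> space (br_endpoints m n w). \<not> edge_between (br_edges m n (w, l)) A B}
      \<subseteq> Pi\<^sub>E {1..m * n} (\<lambda>k. - U k)"
  proof (clarsimp simp: space_br_endpoints PiE_iff edge_between_br_edges_iff)
    fix l k
    assume no: "\<forall>k\<in>{Suc 0..m * n}. \<forall>a\<in>A. \<forall>b\<in>B.
        {br_vertex m n w (br_R m n w k), br_vertex m n w (l k)} \<noteq> {a, b}"
      and k: "Suc 0 \<le> k" "k \<le> m * n" and lU: "l k \<in> U k"
    from lU obtain i where i: "i \<in> C (J k)" "l k \<in> br_interval m n w i" by (auto simp: U_def)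
    have "br_vertex m n w (l k) = i" using i CAB(2) by (intro br_vertex_eq[OF pos]) blast+
    moreover have "br_vertex m n w (br_R m n w k) = J k"
      using J k by (intro br_vertex_br_R[OF pos]) auto
    ultimately have ne: "\<forall>a\<in>A. \<forall>b\<in>B. {J k, i} \<noteq> {a, b}"
      using bspec[OF no, of k] k by simp
    from i(1) have "J k \<in> A \<and> i \<in> B \<or> J k \<in> B \<and> i \<in> A" by (simp add: C_def)
    with ne show False by (auto simp: insert_commute)
  qed
  then have "emeasure (br_endpoints m n w)
      {l \<in> space (br_endpoints m n w). \<not> edge_between (br_edges m n (w, l)) A B}
      \<le> emeasure (br_endpoints m n w) (Pi\<^sub>E {1..m * n} (\<lambda>k. - U k))"
    using U by (intro emeasure_mono) (auto simp: sets_br_endpoints intro!: sets_PiM_I_finite)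
  also have "\<dots> = (\<Prod>k\<in>{1..m * n}. emeasure (density lborel (br_endpoint_density (br_R m n w k))) (- U k))"
    using U by (intro emeasure_br_endpoints) auto
  also have "\<dots> \<le> (\<Prod>k\<in>{1..m * n}. ennreal (exp (- (real (card (C (J k))) * x / (2 * ?W)))))"
  proof (rule prod_mono_ennreal)
    fix k assume k: "k \<in> {1..m * n}"
    have "emeasure (density lborel (br_endpoint_density (br_R m n w k))) (- U k)
        \<le> ennreal (exp (- measure lborel (U k) / 2))"
      using UR[OF k] U br_R_bounds[OF pos k] by (intro emeasure_br_endpoint_Compl_le) auto
    also have "\<dots> \<le> ennreal (exp (- (real (card (C (J k))) * x / (2 * ?W))))"
      using meas[of k] by (intro ennreal_leI) simp
    finally show "emeasure (density lborel (br_endpoint_density (br_R m n w k))) (- U k)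
        \<le> ennreal (exp (- (real (card (C (J k))) * x / (2 * ?W))))" .
  qed
  also have "\<dots> = ennreal (exp (- (real (\<Sum>k=1..m * n. card (C (J k))) * x / (2 * ?W))))"
    by (subst prod_ennreal) (auto simp: exp_sum[symmetric] sum_negf sum_divide_distrib sum_distrib_right)
  also have "\<dots> \<le> ennreal (exp (- (real m * x * real (card A) * real (card B) / (2 * ?W))))"
  proof -
    \<comment> \<open>Each of the \<open>m\<close> indices of block \<open>j\<close> contributes
      \<open>card (C j)\<close>, which produces the factor \<open>m\<close>.\<close>
    have "(\<Sum>k=1..m * n. card (C (J k))) = (\<Sum>j=1..n. \<Sum>k\<in>{m * (j - 1)<..m * j}. card (C (J k)))"
      by (rule sum_blocks)
    also have "\<dots> = (\<Sum>j=1..n. \<Sum>k\<in>{m * (j - 1)<..m * j}. card (C j))"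
      by (intro sum.cong) (auto simp: J_def block_index[simplified])
    also have "\<dots> = (\<Sum>j=1..n. m * card (C j))"
      by (intro sum.cong) (auto simp: diff_mult_distrib2)
    also have "\<dots> \<ge> m * (card A * card B)"
      using card_times_le_sum_smaller[OF AB] unfolding C_def sum_distrib_left[symmetric] by auto
    finally have "m * (card A * card B) \<le> (\<Sum>k=1..m * n. card (C (J k)))" .
    then have "real (m * (card A * card B)) * x \<le> real (\<Sum>k=1..m * n. card (C (J k))) * x"
      using True by (intro mult_right_mono) (simp only: of_nat_le_iff)
    then have "real (m * (card A * card B)) * x / (2 * ?W) \<le> real (\<Sum>k=1..m * n. card (C (J k))) * x / (2 * ?W)"
      using W by (intro divide_right_mono) auto
    then show ?thesis by (intro ennreal_leI) (simp add: mult_ac)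
  qed
  finally show ?thesis .
next
  \<comment> \<open>For negative \<open>x\<close> the claimed bound is at least 1.\<close>
  case False
  interpret subprob_space "br_endpoints m n w" by (rule subprob_space_br_endpoints)
  have "real m * x * real (card A) * real (card B) / (2 * br_W w (m * n + 1)) \<le> 0"
    using False br_W_total_pos[OF pos]
    by (intro divide_nonpos_pos mult_nonpos_nonneg mult_nonneg_nonpos) auto
  then have "1 \<le> ennreal (exp (- (real m * x * real (card A) * real (card B) / (2 * br_W w (m * n + 1)))))"
    by (simp flip: ennreal_1 add: ennreal_leI)
  then show ?thesis using subprob_emeasure_le_1 by (rule order_trans[rotated])
qed

section \<open>Measurability and the joint law\<close>

text \<open>The definite description depends only on the set \<open>J\<close> of matching vertices.
  That set takes finitely many values, so every function of it is measurable, also where it is not a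
  singleton.\<close>

lemma br_vertex_measurable:
  fixes m n :: nat
  defines "N \<equiv> (\<Pi>\<^sub>M i\<in>{1..m * n + 1}. (borel :: real measure)) \<Otimes>\<^sub>M (\<Pi>\<^sub>M k\<in>{1..m * n}. (borel :: real measure))"
  assumes x [measurable]: "x \<in> borel_measurable N"
  shows "(\<lambda>\<omega>. br_vertex m n (fst \<omega>) (x \<omega>)) \<in> N \<rightarrow>\<^sub>M count_space UNIV"
proof -
  define J where "J \<omega> = {j \<in> {1..n}. x \<omega> \<in> br_interval m n (fst \<omega>) j}" for \<omega>
  have R: "(\<lambda>\<omega>. br_R m n (fst \<omega>) k) \<in> borel_measurable N" if "k \<le> m * n" for k
    unfolding br_R_def N_def using that
    by (intro borel_measurable_divide measurable_compose[OF measurable_fst] br_W_measurable) auto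
  have "J \<in> N \<rightarrow>\<^sub>M count_space (Pow {1..n})"
    unfolding measurable_count_space_eq2[OF finite_Pow_iff[THEN iffD2, OF finite_atLeastAtMost]]
  proof (intro conjI ballI)
    show "J \<in> space N \<rightarrow> Pow {1..n}" by (auto simp: J_def)
    fix S assume S: "S \<in> Pow {1..n}"
    have iff: "J \<omega> = S \<longleftrightarrow> (\<forall>j\<in>{1..n}. j \<in> S \<longleftrightarrow>
        br_R m n (fst \<omega>) (m * (j - 1)) < x \<omega> \<and> x \<omega> \<le> br_R m n (fst \<omega>) (m * j))" for \<omega>
    proof -
      have "J \<omega> = S \<longleftrightarrow> (\<forall>j\<in>{1..n}. j \<in> S \<longleftrightarrow> j \<in> J \<omega>)" using S unfolding J_def by blast
      also have "\<dots> \<longleftrightarrow> (\<forall>j\<in>{1..n}. j \<in> S \<longleftrightarrow>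
        br_R m n (fst \<omega>) (m * (j - 1)) < x \<omega> \<and> x \<omega> \<le> br_R m n (fst \<omega>) (m * j))"
        by (intro ball_cong refl) (simp add: J_def br_interval_def)
      finally show ?thesis .
    qed
    have "J -` {S} \<inter> space N = {\<omega> \<in> space N. \<forall>j\<in>{1..n}. j \<in> S \<longleftrightarrow>
        br_R m n (fst \<omega>) (m * (j - 1)) < x \<omega> \<and> x \<omega> \<le> br_R m n (fst \<omega>) (m * j)}"
      unfolding iff[symmetric] by auto
    also have "\<dots> \<in> sets N"
    proof (intro predE pred_intros_finite)
      fix j assume "j \<in> {1..n}"
      then have [measurable]: "(\<lambda>\<omega>. br_R m n (fst \<omega>) (m * (j - 1))) \<in> borel_measurable N"
        "(\<lambda>\<omega>. br_R m n (fst \<omega>) (m * j)) \<in> borel_measurable N"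
        by (auto intro!: R)
      show "Measurable.pred N (\<lambda>\<omega>. j \<in> S \<longleftrightarrow>
          br_R m n (fst \<omega>) (m * (j - 1)) < x \<omega> \<and> x \<omega> \<le> br_R m n (fst \<omega>) (m * j))"
        by measurable
    qed auto
    finally show "J -` {S} \<inter> space N \<in> sets N" .
  qed
  then have "(\<lambda>\<omega>. THE j. j \<in> J \<omega>) \<in> N \<rightarrow>\<^sub>M count_space UNIV"
    by (rule measurable_compose) simp
  then show ?thesis by (simp add: br_vertex_def J_def)
qed

text \<open>There are finitely many edges, and both ends of each are measurable functions with
  values in the natural numbers.\<close>

lemma edge_between_measurable:
  "Measurable.pred ((\<Pi>\<^sub>M i\<in>{1..m * n + 1}. borel) \<Otimes>\<^sub>M (\<Pi>\<^sub>M k\<in>{1..m * n}. borel))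
    (\<lambda>\<omega>. edge_between (br_edges m n \<omega>) A B)"
proof -
  let ?N = "(\<Pi>\<^sub>M i\<in>{1..m * n + 1}. (borel :: real measure)) \<Otimes>\<^sub>M (\<Pi>\<^sub>M k\<in>{1..m * n}. (borel :: real measure))"
  \<comment> \<open>The equality of two doubletons is spelled out as its two possible
    matchings.\<close>
  have "Measurable.pred ?N (\<lambda>\<omega>. \<exists>k\<in>{1..m * n}. \<exists>a b. a \<in> A \<and> b \<in> B \<and>
      (br_vertex m n (fst \<omega>) (br_R m n (fst \<omega>) k) = a \<and> br_vertex m n (fst \<omega>) (snd \<omega> k) = b \<or>
       br_vertex m n (fst \<omega>) (br_R m n (fst \<omega>) k) = b \<and> br_vertex m n (fst \<omega>) (snd \<omega> k) = a))"
  proof (intro pred_intros_finite)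
    fix k assume k: "k \<in> {1..m * n}"
    have "(\<lambda>\<omega>. br_R m n (fst \<omega>) k) \<in> borel_measurable ?N"
      unfolding br_R_def using k
      by (intro borel_measurable_divide measurable_compose[OF measurable_fst] br_W_measurable) auto
    note [measurable] = br_vertex_measurable[OF this]
    have "(\<lambda>\<omega>. snd \<omega> k) \<in> borel_measurable ?N"
      using k by (intro measurable_compose[OF measurable_snd] measurable_component_singleton)
    note [measurable] = br_vertex_measurable[OF this]
    show "Measurable.pred ?N (\<lambda>\<omega>. \<exists>a b. a \<in> A \<and> b \<in> B \<and>
      (br_vertex m n (fst \<omega>) (br_R m n (fst \<omega>) k) = a \<and> br_vertex m n (fst \<omega>) (snd \<omega> k) = b \<or>
       br_vertex m n (fst \<omega>) (br_R m n (fst \<omega>) k) = b \<and> br_vertex m n (fst \<omega>) (snd \<omega> k) = a))"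
      by measurable
  qed auto
  also have "(\<lambda>\<omega>. \<exists>k\<in>{1..m * n}. \<exists>a b. a \<in> A \<and> b \<in> B \<and>
      (br_vertex m n (fst \<omega>) (br_R m n (fst \<omega>) k) = a \<and> br_vertex m n (fst \<omega>) (snd \<omega> k) = b \<or>
       br_vertex m n (fst \<omega>) (br_R m n (fst \<omega>) k) = b \<and> br_vertex m n (fst \<omega>) (snd \<omega> k) = a))
      = (\<lambda>\<omega>. edge_between (br_edges m n \<omega>) A B)"
  proof
    fix \<omega> :: "(nat \<Rightarrow> real) \<times> (nat \<Rightarrow> real)"
    obtain w l where \<omega>: "\<omega> = (w, l)" by (cases \<omega>)
    show "(\<exists>k\<in>{1..m * n}. \<exists>a b. a \<in> A \<and> b \<in> B \<and>
      (br_vertex m n (fst \<omega>) (br_R m n (fst \<omega>) k) = a \<and> br_vertex m n (fst \<omega>) (snd \<omega> k) = b \<or>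
       br_vertex m n (fst \<omega>) (br_R m n (fst \<omega>) k) = b \<and> br_vertex m n (fst \<omega>) (snd \<omega> k) = a))
      \<longleftrightarrow> edge_between (br_edges m n \<omega>) A B"
      unfolding \<omega> edge_between_br_edges_iff fst_conv snd_conv doubleton_eq_iff by blast
  qed
  finally show ?thesis .
qed

lemma no_edge_sets_br_endpoints:
  assumes w: "w \<in> space (br_weights m n)"
  shows "{l \<in> space (br_endpoints m n w). \<not> edge_between (br_edges m n (w, l)) A B}
    \<in> sets (br_endpoints m n w)"
proof -
  have w': "w \<in> space (\<Pi>\<^sub>M i\<in>{1..m * n + 1}. borel)"
    using w sets_eq_imp_space_eq[OF sets_br_weights[of m n]] by simp
  have "Pair w \<in> (\<Pi>\<^sub>M k\<in>{1..m * n}. borel) \<rightarrow>\<^sub>M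
      (\<Pi>\<^sub>M i\<in>{1..m * n + 1}. (borel :: real measure)) \<Otimes>\<^sub>M (\<Pi>\<^sub>M k\<in>{1..m * n}. (borel :: real measure))"
    by (rule measurable_Pair1'[OF w'])
  from measurable_compose[OF this edge_between_measurable]
  have "Measurable.pred (br_endpoints m n w) (\<lambda>l. edge_between (br_edges m n (w, l)) A B)"
    by (simp cong: measurable_cong_sets add: sets_br_endpoints)
  then show ?thesis by measurable
qed

text \<open>Disintegration over the weights: the outer bind is an integral over \<open>w\<close>,
  and the inner one integrates the indicator of the slice of \<open>X\<close> at \<open>w\<close>.
  Bounds for fixed weights thereby pass to the joint law.\<close>

lemma emeasure_br_law:
  assumes X: "X \<in> sets ((\<Pi>\<^sub>M i\<in>{1..m * n + 1}. borel) \<Otimes>\<^sub>M (\<Pi>\<^sub>M k\<in>{1..m * n}. borel))"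
  shows "emeasure (br_law m n) X =
    (\<integral>\<^sup>+w. emeasure (br_endpoints m n w) {l \<in> space (br_endpoints m n w). (w, l) \<in> X} \<partial>br_weights m n)"
proof -
  let ?N = "(\<Pi>\<^sub>M i\<in>{1..m * n + 1}. (borel :: real measure)) \<Otimes>\<^sub>M (\<Pi>\<^sub>M k\<in>{1..m * n}. (borel :: real measure))"
  interpret prob_space "br_weights m n" by (rule prob_space_br_weights)
  have kernel: "(\<lambda>w. br_endpoints m n w \<bind> (\<lambda>l. return ?N (w, l))) \<in> br_weights m n \<rightarrow>\<^sub>M subprob_algebra ?N"
  proof (rule measurable_bind[OF br_endpoints_measurable])
    have "(\<lambda>x. x) \<in> br_weights m n \<Otimes>\<^sub>M (\<Pi>\<^sub>M k\<in>{1..m * n}. borel) \<rightarrow>\<^sub>M ?N"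
      by (intro measurable_ident_sets sets_pair_measure_cong sets_br_weights refl)
    then show "(\<lambda>x. return ?N (fst x, snd x))
        \<in> br_weights m n \<Otimes>\<^sub>M (\<Pi>\<^sub>M k\<in>{1..m * n}. borel) \<rightarrow>\<^sub>M subprob_algebra ?N"
      by (simp add: measurable_compose[OF _ return_measurable])
  qed
  have "emeasure (br_law m n) X =
      (\<integral>\<^sup>+w. emeasure (br_endpoints m n w \<bind> (\<lambda>l. return ?N (w, l))) X \<partial>br_weights m n)"
    unfolding br_law_def by (rule emeasure_bind[OF not_empty kernel X])
  also have "\<dots> = (\<integral>\<^sup>+w. emeasure (br_endpoints m n w) {l \<in> space (br_endpoints m n w). (w, l) \<in> X} \<partial>br_weights m n)"
  proof (rule nn_integral_cong)
    fix w assume w: "w \<in> space (br_weights m n)"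
    interpret E: subprob_space "br_endpoints m n w" by (rule subprob_space_br_endpoints)
    have w': "w \<in> space (\<Pi>\<^sub>M i\<in>{1..m * n + 1}. borel)"
      using w sets_eq_imp_space_eq[OF sets_br_weights[of m n]] by simp
    have pair: "Pair w \<in> br_endpoints m n w \<rightarrow>\<^sub>M ?N"
      using measurable_Pair1'[OF w'] by (simp cong: measurable_cong_sets add: sets_br_endpoints)
    have slice: "{l \<in> space (br_endpoints m n w). (w, l) \<in> X} \<in> sets (br_endpoints m n w)"
      using measurable_sets[OF pair X] by (simp add: vimage_def Int_def conj_commute)
    have "emeasure (br_endpoints m n w \<bind> (\<lambda>l. return ?N (w, l))) X =
        (\<integral>\<^sup>+l. emeasure (return ?N (w, l)) X \<partial>br_endpoints m n w)"
      by (rule emeasure_bind[OF E.subprob_not_empty measurable_compose[OF pair return_measurable] X])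
    also have "\<dots> = (\<integral>\<^sup>+l. indicator {l \<in> space (br_endpoints m n w). (w, l) \<in> X} l \<partial>br_endpoints m n w)"
      using X by (intro nn_integral_cong) (auto simp: indicator_def)
    also have "\<dots> = emeasure (br_endpoints m n w) {l \<in> space (br_endpoints m n w). (w, l) \<in> X}"
      using slice by simp
    finally show "emeasure (br_endpoints m n w \<bind> (\<lambda>l. return ?N (w, l))) X =
        emeasure (br_endpoints m n w) {l \<in> space (br_endpoints m n w). (w, l) \<in> X}" .
  qed
  finally show ?thesis .
qed

section \<open>Union bounds\<close>

text \<open>For fixed weights the vertices with short blocks, the set \<open>Z\<close>, are
  discarded. Each \<open>s\<close>-set keeps at least \<open>s - z\<close> vertices, the bound for
  one pair applies to what is left, and a union bound over pairs of \<open>s\<close>-sets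
  finishes.\<close>

lemma emeasure_no_edge_pair_le:
  assumes m: "0 < m" and w: "w \<in> space (br_weights m n)" "\<forall>i\<in>{1..m * n + 1}. 0 < w i"
    and V: "br_W w (m * n + 1) \<le> V" and x: "0 \<le> x"
    and z: "real (card {i \<in> {1..n}. br_block m w i < x}) \<le> z" "z \<le> real s"
  shows "emeasure (br_endpoints m n w) {l \<in> space (br_endpoints m n w).
      \<exists>A B. A \<subseteq> {1..n} \<and> B \<subseteq> {1..n} \<and> A \<inter> B = {} \<and> s \<le> card A \<and> s \<le> card B \<and>
        \<not> edge_between (br_edges m n (w, l)) A B}
    \<le> ennreal (real (n choose s) ^ 2 * exp (- (real m * x * (real s - z)\<^sup>2 / (2 * V))))"
proof -
  define E where "E = (\<lambda>(A, B). {l \<in> space (br_endpoints m n w). \<not> edge_between (br_edges m n (w, l)) A B})"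
  define P where "P = {A. A \<subseteq> {1..n} \<and> card A = s}"
  define Q where "Q = {p \<in> P \<times> P. fst p \<inter> snd p = {}}"
  define Z where "Z = {i \<in> {1..n}. br_block m w i < x}"
  let ?b = "exp (- (real m * x * (real s - z)\<^sup>2 / (2 * V)))"
  have W: "0 < br_W w (m * n + 1)" by (rule br_W_total_pos[OF w(2)])
  have finP: "finite P" unfolding P_def by (rule finite_subset[of _ "Pow {1..n}"]) auto
  then have finQ: "finite Q" by (simp add: Q_def)
  have cardP: "card P = n choose s" unfolding P_def using n_subsets[of "{1..n}" s] by simp
  have meas: "E p \<in> sets (br_endpoints m n w)" for p
    unfolding E_def using no_edge_sets_br_endpoints[OF w(1)] by (auto split: prod.split)
  \<comment> \<open>Absence of edges passes to subsets. This serves twice: to remove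
    \<open>Z\<close>, and to shrink large sets to exactly \<open>s\<close> elements.\<close>
  have mono: "E (A, B) \<subseteq> E (A', B')" if "A' \<subseteq> A" "B' \<subseteq> B" for A B A' B'
    using that by (auto simp: E_def edge_between_def)
  have bound: "emeasure (br_endpoints m n w) (E p) \<le> ennreal ?b" if p: "p \<in> Q" for p
  proof -
    obtain A B where AB: "p = (A, B)" by (cases p)
    have AB': "A \<subseteq> {1..n}" "B \<subseteq> {1..n}" "card A = s" "card B = s" "A \<inter> B = {}"
      using p by (auto simp: Q_def P_def AB)
    have ge: "real s - z \<le> real (card (C - Z))" if "C \<subseteq> {1..n}" "card C = s" for C
    proof -
      have "card C - card Z \<le> card (C - Z)"
        using that by (intro diff_card_le_card_Diff) (auto simp: Z_def)
      then have "real (card C) - real (card Z) \<le> real (card (C - Z))" by linarith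
      then show ?thesis using z(1) that unfolding Z_def by linarith
    qed
    have "emeasure (br_endpoints m n w) (E p) \<le> emeasure (br_endpoints m n w) (E (A - Z, B - Z))"
      unfolding AB by (intro emeasure_mono mono meas) auto
    also have "\<dots> \<le> ennreal (exp (- (real m * x * real (card (A - Z)) * real (card (B - Z)) / (2 * br_W w (m * n + 1)))))"
      unfolding E_def split_conv using AB'
      by (intro emeasure_no_edge_le[OF m w(2)]) (auto simp: Z_def not_less)
    also have "\<dots> \<le> ennreal ?b"
    proof -
      \<comment> \<open>The two lower bounds may be multiplied because \<open>z \<le> real s\<close>
        makes them nonnegative.\<close>
      have "(real s - z)\<^sup>2 \<le> real (card (A - Z)) * real (card (B - Z))"
        unfolding power2_eq_square using ge AB' z(2) by (intro mult_mono) auto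
      then have "real m * x * (real s - z)\<^sup>2 / (2 * V)
          \<le> real m * x * (real (card (A - Z)) * real (card (B - Z))) / (2 * br_W w (m * n + 1))"
        using x W V by (intro frac_le mult_left_mono mult_nonneg_nonneg) auto
      then show ?thesis by (intro ennreal_leI) (simp add: mult.assoc)
    qed
    finally show ?thesis .
  qed
  have "{l \<in> space (br_endpoints m n w).
      \<exists>A B. A \<subseteq> {1..n} \<and> B \<subseteq> {1..n} \<and> A \<inter> B = {} \<and> s \<le> card A \<and> s \<le> card B \<and>
        \<not> edge_between (br_edges m n (w, l)) A B} \<subseteq> (\<Union>p\<in>Q. E p)"
  proof
    fix l assume "l \<in> {l \<in> space (br_endpoints m n w).
      \<exists>A B. A \<subseteq> {1..n} \<and> B \<subseteq> {1..n} \<and> A \<inter> B = {} \<and> s \<le> card A \<and> s \<le> card B \<and>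
        \<not> edge_between (br_edges m n (w, l)) A B}"
    then obtain A B where AB: "A \<subseteq> {1..n}" "B \<subseteq> {1..n}" "A \<inter> B = {}" "s \<le> card A" "s \<le> card B"
      and l: "l \<in> E (A, B)" by (auto simp: E_def)
    obtain A' where A': "A' \<subseteq> A" "card A' = s" using AB(4) by (rule obtain_subset_with_card_n)
    obtain B' where B': "B' \<subseteq> B" "card B' = s" using AB(5) by (rule obtain_subset_with_card_n)
    have "(A', B') \<in> Q" using A' B' AB by (auto simp: Q_def P_def)
    moreover have "l \<in> E (A', B')" using mono[OF A'(1) B'(1)] l by auto
    ultimately show "l \<in> (\<Union>p\<in>Q. E p)" by blast
  qed
  then have "emeasure (br_endpoints m n w) {l \<in> space (br_endpoints m n w).
      \<exists>A B. A \<subseteq> {1..n} \<and> B \<subseteq> {1..n} \<and> A \<inter> B = {} \<and> s \<le> card A \<and> s \<le> card B \<and>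
        \<not> edge_between (br_edges m n (w, l)) A B} \<le> emeasure (br_endpoints m n w) (\<Union>p\<in>Q. E p)"
    using meas finQ by (intro emeasure_mono) auto
  also have "\<dots> \<le> (\<Sum>p\<in>Q. emeasure (br_endpoints m n w) (E p))"
    using meas finQ by (intro emeasure_subadditive_finite) auto
  also have "\<dots> \<le> (\<Sum>p\<in>Q. ennreal ?b)" by (intro sum_mono bound)
  also have "\<dots> = ennreal (real (card Q) * ?b)"
    by (simp add: ennreal_of_nat_eq_real_of_nat ennreal_mult'')
  also have "\<dots> \<le> ennreal (real (n choose s) ^ 2 * ?b)"
  proof (intro ennreal_leI mult_right_mono)
    have "card Q \<le> card (P \<times> P)" using finP by (intro card_mono) (auto simp: Q_def)
    also have "\<dots> = (n choose s) ^ 2" by (simp add: card_cartesian_product cardP power2_eq_square)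
    finally show "real (card Q) \<le> real (n choose s) ^ 2"
      by (metis of_nat_le_iff of_nat_power)
  qed auto
  finally show ?thesis .
qed

section \<open>Tails of the total weight and of sums of blocks\<close>

lemma emeasure_br_W_large_le:
  assumes \<epsilon>: "0 < \<epsilon>" "\<epsilon> \<le> 1"
  shows "emeasure (br_weights m n) {w \<in> space (br_weights m n). (1 + \<epsilon>) * (real m * real n) \<le> br_W w (m * n + 1)}
    \<le> ennreal (exp (1 - \<epsilon>\<^sup>2 / 8 * (real m * real n)))"
proof -
  \<comment> \<open>This \<open>u\<close> minimises \<open>2 * u\<^sup>2 - \<epsilon> * u\<close>,
    the exponent per weight resulting from
    \<open>ln (1 - u) \<ge> - u - 2 * u\<^sup>2\<close>.\<close>
  define u where "u = \<epsilon> / 4"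
  have u: "0 < u" "u \<le> 1 / 4" using \<epsilon> by (auto simp: u_def)
  let ?c = "(1 + \<epsilon>) * (real m * real n)"
  have "{w \<in> space (br_weights m n). ?c \<le> br_W w (m * n + 1)} =
      {w \<in> space (br_weights m n). - u * (\<Sum>i\<in>{1..m * n + 1}. w i) \<le> - u * ?c}"
    using u by (auto simp: br_W_def)
  also have "emeasure (br_weights m n) \<dots> \<le> ennreal (exp (- u * ?c) / (1 + - u) ^ card {1..m * n + 1})"
    using u by (intro br_weights_chernoff) auto
  also have "\<dots> \<le> ennreal (exp (1 - \<epsilon>\<^sup>2 / 8 * (real m * real n)))"
  proof (rule ennreal_leI)
    have "- u - 2 * u\<^sup>2 \<le> ln (1 - u)" using ln_one_minus_pos_lower_bound[of u] u by simp
    then have "exp (- u - 2 * u\<^sup>2) \<le> 1 - u" using u by (subst (asm) ln_ge_iff) auto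
    then have "exp (- u - 2 * u\<^sup>2) ^ (m * n + 1) \<le> (1 - u) ^ (m * n + 1)" by (intro power_mono) auto
    then have "exp (- u * ?c) / (1 - u) ^ (m * n + 1) \<le> exp (- u * ?c) / exp (- u - 2 * u\<^sup>2) ^ (m * n + 1)"
      using u by (intro divide_left_mono mult_pos_pos zero_less_power) auto
    also have "\<dots> = exp (- u * ?c - real (m * n + 1) * (- u - 2 * u\<^sup>2))"
      by (subst exp_of_nat_mult[symmetric]) (rule exp_diff[symmetric])
    \<comment> \<open>The threshold \<open>?c\<close> counts \<open>m * n\<close> weights while the
      sum has one more; the extra weight leaves \<open>u + 2 * u\<^sup>2\<close>, absorbed by the 1
      in the final exponent.\<close>
    also have "- u * ?c - real (m * n + 1) * (- u - 2 * u\<^sup>2) = u + 2 * u\<^sup>2 - 2 * u\<^sup>2 * (real m * real n)"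
      by (simp add: u_def field_simps power2_eq_square)
    also have "u + 2 * u\<^sup>2 \<le> 1"
    proof -
      have "2 * u\<^sup>2 \<le> 1 / 2" using u mult_mono[of u "1 / 4" u 1] by (simp add: power2_eq_square)
      then show ?thesis using u by linarith
    qed
    then have "exp (u + 2 * u\<^sup>2 - 2 * u\<^sup>2 * (real m * real n)) \<le> exp (1 - \<epsilon>\<^sup>2 / 8 * (real m * real n))"
      by (simp add: u_def power_divide)
    finally show "exp (- u * ?c) / (1 + - u) ^ card {1..m * n + 1} \<le> exp (1 - \<epsilon>\<^sup>2 / 8 * (real m * real n))"
      by simp
  qed
  finally show ?thesis .
qed

text \<open>Blocks of distinct vertices are disjoint, so the sum consists of
  \<open>m * card S\<close> independent weights of mean 1. Measurability is recorded as well for the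
  union bound over \<open>S\<close>.\<close>

lemma emeasure_br_block_sum_small_le:
  assumes \<epsilon>: "0 < \<epsilon>" "\<epsilon> \<le> 1" and S: "S \<subseteq> {1..n}"
  shows "emeasure (br_weights m n) {w \<in> space (br_weights m n).
      (\<Sum>j\<in>S. br_block m w j) \<le> (1 - \<epsilon>) * (real m * real (card S))}
    \<le> ennreal (exp (- (\<epsilon>\<^sup>2 / 4 * (real m * real (card S)))))"
    and "{w \<in> space (br_weights m n). (\<Sum>j\<in>S. br_block m w j) \<le> (1 - \<epsilon>) * (real m * real (card S))}
      \<in> sets (br_weights m n)"
proof -
  \<comment> \<open>This \<open>u\<close> minimises \<open>u\<^sup>2 - \<epsilon> * u\<close>, the
    exponent per weight resulting from \<open>ln (1 + u) \<ge> u - u\<^sup>2\<close>.\<close>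
  define u where "u = \<epsilon> / 2"
  have u: "0 < u" "u \<le> 1 / 2" using \<epsilon> by (auto simp: u_def)
  define I where "I = (\<Union>j\<in>S. {m * (j - 1)<..m * j})"
  let ?c = "(1 - \<epsilon>) * (real m * real (card S))"
  have fin: "finite S" using S by (rule finite_subset) auto
  \<comment> \<open>A common index would determine both vertices by
    \<open>block_index\<close>.\<close>
  have disj: "{m * (i - 1)<..m * i} \<inter> {m * (j - 1)<..m * j} = {}" if "i \<in> S" "j \<in> S" "i \<noteq> j" for i j
  proof (rule ccontr)
    assume "{m * (i - 1)<..m * i} \<inter> {m * (j - 1)<..m * j} \<noteq> {}"
    then obtain k where "k \<in> {m * (i - 1)<..m * i}" "k \<in> {m * (j - 1)<..m * j}" by blast
    moreover have "0 < i" "0 < j" using that S by auto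
    ultimately show False using block_index[of k m i] block_index[of k m j] that by auto
  qed
  have I: "I \<subseteq> {1..m * n + 1}"
  proof
    fix k assume "k \<in> I"
    then obtain j where j: "j \<in> S" "m * (j - 1) < k" "k \<le> m * j" by (auto simp: I_def)
    then have "m * j \<le> m * n" using S by auto
    with j show "k \<in> {1..m * n + 1}" unfolding atLeastAtMost_iff by linarith
  qed
  have cardI: "card I = m * card S"
  proof -
    have "card I = (\<Sum>j\<in>S. card {m * (j - 1)<..m * j})"
      unfolding I_def using fin disj by (intro card_UN_disjoint) auto
    also have "\<dots> = (\<Sum>j\<in>S. m)"
    proof (intro sum.cong refl)
      fix j assume "j \<in> S"
      then have "0 < j" using S by auto
      then show "card {m * (j - 1)<..m * j} = m" by (cases j) auto
    qed
    finally show ?thesis by simp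
  qed
  have sumI: "(\<Sum>i\<in>I. w i) = (\<Sum>j\<in>S. br_block m w j)" for w :: "nat \<Rightarrow> real"
  proof -
    have "(\<Sum>i\<in>I. w i) = (\<Sum>j\<in>S. \<Sum>i\<in>{m * (j - 1)<..m * j}. w i)"
      unfolding I_def using fin disj by (intro sum.UNION_disjoint) auto
    also have "\<dots> = (\<Sum>j\<in>S. br_block m w j)"
      using S by (intro sum.cong refl br_block_eq_sum[symmetric]) auto
    finally show ?thesis .
  qed
  have eq: "{w \<in> space (br_weights m n). (\<Sum>j\<in>S. br_block m w j) \<le> ?c} =
      {w \<in> space (br_weights m n). u * (\<Sum>i\<in>I. w i) \<le> u * ?c}"
    using u by (auto simp: sumI)
  note br_weights_sum_measurable[OF I, measurable]
  show "{w \<in> space (br_weights m n). (\<Sum>j\<in>S. br_block m w j) \<le> ?c} \<in> sets (br_weights m n)"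
    unfolding eq by measurable
  have "emeasure (br_weights m n) {w \<in> space (br_weights m n). (\<Sum>j\<in>S. br_block m w j) \<le> ?c}
      \<le> ennreal (exp (u * ?c) / (1 + u) ^ card I)"
    unfolding eq using u by (intro br_weights_chernoff I) auto
  also have "\<dots> \<le> ennreal (exp (- (\<epsilon>\<^sup>2 / 4 * (real m * real (card S)))))"
  proof (rule ennreal_leI)
    have "u - u\<^sup>2 \<le> ln (1 + u)" using u by (intro ln_one_plus_pos_lower_bound) auto
    then have "exp (u - u\<^sup>2) \<le> 1 + u" using u by (subst (asm) ln_ge_iff) auto
    then have "exp (u - u\<^sup>2) ^ card I \<le> (1 + u) ^ card I" by (intro power_mono) auto
    then have "exp (u * ?c) / (1 + u) ^ card I \<le> exp (u * ?c) / exp (u - u\<^sup>2) ^ card I"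
      using u by (intro divide_left_mono mult_pos_pos zero_less_power) auto
    also have "\<dots> = exp (u * ?c - real (m * card S) * (u - u\<^sup>2))"
      unfolding cardI by (subst exp_of_nat_mult[symmetric]) (rule exp_diff[symmetric])
    also have "u * ?c - real (m * card S) * (u - u\<^sup>2) = - (\<epsilon>\<^sup>2 / 4 * (real m * real (card S)))"
      by (simp add: u_def field_simps power2_eq_square)
    finally show "exp (u * ?c) / (1 + u) ^ card I \<le> exp (- (\<epsilon>\<^sup>2 / 4 * (real m * real (card S))))" .
  qed
  finally show "emeasure (br_weights m n) {w \<in> space (br_weights m n). (\<Sum>j\<in>S. br_block m w j) \<le> ?c}
      \<le> ennreal (exp (- (\<epsilon>\<^sup>2 / 4 * (real m * real (card S)))))" .
qed

text \<open>If \<open>z\<close> blocks are small, then so is the sum of the weights over these blocks; the bound is a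
  union over the possible sets of small blocks.\<close>

lemma many_small_blocks_event:
  assumes \<epsilon>: "0 < \<epsilon>" "\<epsilon> \<le> 1" and z: "real n \<le> \<epsilon>\<^sup>2 / 4 * (real m * z)"
  shows "\<exists>T \<in> sets (br_weights m n). emeasure (br_weights m n) T \<le> ennreal (2 ^ n * exp (- real n)) \<and>
    {w \<in> space (br_weights m n). z \<le> real (card {i \<in> {1..n}. br_block m w i < (1 - \<epsilon>) * real m})} \<subseteq> T"
proof -
  define F where "F S = {w \<in> space (br_weights m n). (\<Sum>j\<in>S. br_block m w j) \<le> (1 - \<epsilon>) * (real m * real (card S))}" for S
  \<comment> \<open>\<open>D\<close> has at most \<open>2 ^ n\<close> members, and the assumption on
    \<open>z\<close> gives each \<open>F S\<close> probability at most
    \<open>exp (- real n)\<close>. The crude count suffices because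
    \<open>2 < exp 1\<close>.\<close>
  define D where "D = {S. S \<subseteq> {1..n} \<and> z \<le> real (card S)}"
  have D: "D \<subseteq> Pow {1..n}" "finite D" by (auto simp: D_def)
  have F: "F S \<in> sets (br_weights m n)" if "S \<in> D" for S
    unfolding F_def using that by (intro emeasure_br_block_sum_small_le(2)[OF \<epsilon>]) (auto simp: D_def)
  have "emeasure (br_weights m n) (\<Union>S\<in>D. F S) \<le> (\<Sum>S\<in>D. emeasure (br_weights m n) (F S))"
    using D F by (intro emeasure_subadditive_finite) auto
  also have "\<dots> \<le> (\<Sum>S\<in>D. ennreal (exp (- real n)))"
  proof (rule sum_mono)
    fix S assume S: "S \<in> D"
    have "emeasure (br_weights m n) (F S) \<le> ennreal (exp (- (\<epsilon>\<^sup>2 / 4 * (real m * real (card S)))))"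
      unfolding F_def using S by (intro emeasure_br_block_sum_small_le(1)[OF \<epsilon>]) (auto simp: D_def)
    also have "\<dots> \<le> ennreal (exp (- real n))"
    proof -
      have "real n \<le> \<epsilon>\<^sup>2 / 4 * (real m * z)" by (rule z)
      also have "\<dots> \<le> \<epsilon>\<^sup>2 / 4 * (real m * real (card S))"
        using S by (intro mult_left_mono) (auto simp: D_def)
      finally show ?thesis by (intro ennreal_leI) simp
    qed
    finally show "emeasure (br_weights m n) (F S) \<le> ennreal (exp (- real n))" .
  qed
  also have "\<dots> = ennreal (real (card D) * exp (- real n))"
    by (simp add: ennreal_of_nat_eq_real_of_nat ennreal_mult'')
  also have "\<dots> \<le> ennreal (2 ^ n * exp (- real n))"
  proof (intro ennreal_leI mult_right_mono)
    have "card D \<le> card (Pow {1..n})" using D by (intro card_mono) auto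
    then have "card D \<le> 2 ^ n" by (simp add: card_Pow)
    then show "real (card D) \<le> 2 ^ n" by (metis of_nat_le_iff of_nat_numeral of_nat_power)
  qed auto
  finally have "emeasure (br_weights m n) (\<Union>S\<in>D. F S) \<le> ennreal (2 ^ n * exp (- real n))" .
  moreover have "{w \<in> space (br_weights m n). z \<le> real (card {i \<in> {1..n}. br_block m w i < (1 - \<epsilon>) * real m})}
      \<subseteq> (\<Union>S\<in>D. F S)"
  proof clarify
    fix w assume w: "w \<in> space (br_weights m n)"
      and le: "z \<le> real (card {i \<in> {1..n}. br_block m w i < (1 - \<epsilon>) * real m})"
    let ?S = "{i \<in> {1..n}. br_block m w i < (1 - \<epsilon>) * real m}"
    have "(\<Sum>j\<in>?S. br_block m w j) \<le> real (card ?S) * ((1 - \<epsilon>) * real m)"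
      by (rule sum_bounded_above) auto
    then have "w \<in> F ?S" using w by (simp add: F_def mult_ac)
    moreover have "?S \<in> D" using le by (auto simp: D_def)
    ultimately show "w \<in> (\<Union>S\<in>D. F S)" by blast
  qed
  moreover have "(\<Union>S\<in>D. F S) \<in> sets (br_weights m n)" using D F by auto
  ultimately show ?thesis by blast
qed

lemma no_edge_pair_sets:
  "{\<omega> \<in> space (br_law m n). \<exists>A B. A \<subseteq> {1..n} \<and> B \<subseteq> {1..n} \<and> A \<inter> B = {} \<and> s \<le> card A \<and> s \<le> card B \<and>
      \<not> edge_between (br_edges m n \<omega>) A B}
    \<in> sets ((\<Pi>\<^sub>M i\<in>{1..m * n + 1}. borel) \<Otimes>\<^sub>M (\<Pi>\<^sub>M k\<in>{1..m * n}. borel))" (is "?X \<in> sets ?N")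
  and sets_br_law: "sets (br_law m n) = sets ((\<Pi>\<^sub>M i\<in>{1..m * n + 1}. borel) \<Otimes>\<^sub>M (\<Pi>\<^sub>M k\<in>{1..m * n}. borel))"
proof -
  interpret prob_space "br_weights m n" by (rule prob_space_br_weights)
  show sets: "sets (br_law m n) = sets ?N"
    unfolding br_law_def
    by (rule sets_bind[OF _ not_empty], rule sets_bind)
       (auto simp: space_br_endpoints PiE_eq_empty_iff)
  have "{\<omega> \<in> space ?N. \<exists>A\<in>Pow {1..n}. \<exists>B\<in>Pow {1..n}. A \<inter> B = {} \<and> s \<le> card A \<and> s \<le> card B \<and>
      \<not> edge_between (br_edges m n \<omega>) A B} \<in> sets ?N"
  proof (intro predE pred_intros_finite)
    fix A B
    have [measurable]: "Measurable.pred ?N (\<lambda>\<omega>. edge_between (br_edges m n \<omega>) A B)"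
      by (rule edge_between_measurable)
    show "Measurable.pred ?N (\<lambda>\<omega>. A \<inter> B = {} \<and> s \<le> card A \<and> s \<le> card B \<and>
      \<not> edge_between (br_edges m n \<omega>) A B)" by measurable
  qed auto
  also have "{\<omega> \<in> space ?N. \<exists>A\<in>Pow {1..n}. \<exists>B\<in>Pow {1..n}. A \<inter> B = {} \<and> s \<le> card A \<and> s \<le> card B \<and>
      \<not> edge_between (br_edges m n \<omega>) A B} = ?X"
    unfolding sets_eq_imp_space_eq[OF sets] by blast
  finally show "?X \<in> sets ?N" .
qed

text \<open>The first two terms pay for weights with a large total or with at least
  \<open>\<epsilon> * real s\<close> short blocks. On all other weights the bound for fixed weights
  applies with \<open>x = (1 - \<epsilon>) * real m\<close> and
  \<open>z = \<epsilon> * real s\<close>; the assumption on \<open>s\<close> is what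
  \<open>many_small_blocks_event\<close> demands for this \<open>z\<close>.\<close>

lemma emeasure_br_law_no_edge_pair_le:
  fixes \<epsilon> :: real
  assumes m: "0 < m" and \<epsilon>: "0 < \<epsilon>" "\<epsilon> \<le> 1" and s: "real n \<le> \<epsilon>\<^sup>2 / 4 * (real m * (\<epsilon> * real s))"
  shows "emeasure (br_law m n) {\<omega> \<in> space (br_law m n). \<exists>A B. A \<subseteq> {1..n} \<and> B \<subseteq> {1..n} \<and> A \<inter> B = {} \<and>
      s \<le> card A \<and> s \<le> card B \<and> \<not> edge_between (br_edges m n \<omega>) A B}
    \<le> ennreal (exp (1 - \<epsilon>\<^sup>2 / 8 * (real m * real n)) + 2 ^ n * exp (- real n) +
      real (n choose s) ^ 2 * exp (- (real m * ((1 - \<epsilon>) * real m) * (real s - \<epsilon> * real s)\<^sup>2 /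
        (2 * ((1 + \<epsilon>) * (real m * real n))))))"
    (is "emeasure _ ?X \<le> ennreal (?p + ?q + ?r)")
proof -
  interpret W: prob_space "br_weights m n" by (rule prob_space_br_weights)
  let ?V = "(1 + \<epsilon>) * (real m * real n)"
  let ?E = "\<lambda>w. {l \<in> space (br_endpoints m n w). (w, l) \<in> ?X}"
  \<comment> \<open>\<open>T\<close> is a measurable set containing the weights with many short
    blocks, so its indicator can be integrated.\<close>
  obtain T where T: "T \<in> sets (br_weights m n)" "emeasure (br_weights m n) T \<le> ennreal ?q"
    "{w \<in> space (br_weights m n). \<epsilon> * real s \<le> real (card {i \<in> {1..n}. br_block m w i < (1 - \<epsilon>) * real m})} \<subseteq> T"
    using many_small_blocks_event[OF \<epsilon> s] by blast
  define S where "S = {w \<in> space (br_weights m n). ?V \<le> br_W w (m * n + 1)}"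
  have S: "S \<in> sets (br_weights m n)" "emeasure (br_weights m n) S \<le> ennreal ?p"
  proof -
    have [measurable]: "(\<lambda>w. br_W w (m * n + 1)) \<in> borel_measurable (br_weights m n)"
      unfolding br_W_def by (rule br_weights_sum_measurable) auto
    show "S \<in> sets (br_weights m n)" unfolding S_def by measurable
    show "emeasure (br_weights m n) S \<le> ennreal ?p"
      unfolding S_def by (rule emeasure_br_W_large_le[OF \<epsilon>])
  qed
  have "emeasure (br_law m n) ?X = (\<integral>\<^sup>+w. emeasure (br_endpoints m n w) (?E w) \<partial>br_weights m n)"
    by (rule emeasure_br_law[OF no_edge_pair_sets])
  also have "\<dots> \<le> (\<integral>\<^sup>+w. indicator S w + indicator T w + ennreal ?r \<partial>br_weights m n)"
  proof (rule nn_integral_mono_AE)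
    \<comment> \<open>On \<open>S\<close> or \<open>T\<close> an indicator covers the trivial bound
      1; elsewhere \<open>?r\<close> is the conditional bound.\<close>
    show "AE w in br_weights m n. emeasure (br_endpoints m n w) (?E w) \<le> indicator S w + indicator T w + ennreal ?r"
      using AE_br_weights_pos AE_space
    proof eventually_elim
      fix w assume pos: "\<forall>i\<in>{1..m * n + 1}. 0 < w i" and w: "w \<in> space (br_weights m n)"
      interpret E: subprob_space "br_endpoints m n w" by (rule subprob_space_br_endpoints)
      show "emeasure (br_endpoints m n w) (?E w) \<le> indicator S w + indicator T w + ennreal ?r"
      proof (cases "w \<in> S \<or> w \<in> T")
        case True
        then have "1 \<le> indicator S w + indicator T w + ennreal ?r"
          by (auto simp: indicator_def add.assoc intro: add_increasing2)
        then show ?thesis using E.subprob_emeasure_le_1 by (rule order_trans[rotated])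
      next
        case False
        then have V: "br_W w (m * n + 1) \<le> ?V" using w by (auto simp: S_def)
        have z: "real (card {i \<in> {1..n}. br_block m w i < (1 - \<epsilon>) * real m}) \<le> \<epsilon> * real s"
          using False w T(3) by (intro less_imp_le) (auto simp: not_le[symmetric])
        have eq: "?E w = {l \<in> space (br_endpoints m n w).
            \<exists>A B. A \<subseteq> {1..n} \<and> B \<subseteq> {1..n} \<and> A \<inter> B = {} \<and> s \<le> card A \<and> s \<le> card B \<and>
              \<not> edge_between (br_edges m n (w, l)) A B}"
        proof -
          have "(w, l) \<in> space (br_law m n)" if "l \<in> space (br_endpoints m n w)" for l
            using that w unfolding sets_eq_imp_space_eq[OF sets_br_law]
              sets_eq_imp_space_eq[OF sets_br_endpoints] sets_eq_imp_space_eq[OF sets_br_weights]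
            by (simp add: space_pair_measure)
          then show ?thesis by blast
        qed
        have "emeasure (br_endpoints m n w) (?E w) \<le> ennreal ?r"
          unfolding eq using \<epsilon> mult_right_mono[of \<epsilon> 1 "real s"]
          by (intro emeasure_no_edge_pair_le[OF m w pos V _ z]) auto
        then show ?thesis by (simp add: add_increasing)
      qed
    qed
  qed
  also have "\<dots> = emeasure (br_weights m n) S + emeasure (br_weights m n) T + ennreal ?r"
    using S T by (simp add: nn_integral_add W.emeasure_space_1)
  also have "\<dots> \<le> ennreal ?p + ennreal ?q + ennreal ?r"
    using S(2) T(2) by (intro add_mono) auto
  also have "\<dots> = ennreal (?p + ?q + ?r)" by (simp add: ennreal_plus)
  finally show ?thesis .
qed

section \<open>Asymptotics\<close>

text \<open>With \<open>x = s / n\<close>, one term of the binomial expansion of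
  \<open>(1 + x) ^ n\<close> is at most the whole sum, which is at most
  \<open>exp x ^ n = exp s\<close>.\<close>

lemma binomial_le_exp_power:
  assumes s: "0 < s"
  shows "real (n choose s) \<le> (exp 1 * real n / real s) ^ s"
proof (cases "n = 0")
  case False
  define x where "x = real s / real n"
  have x: "0 < x" using s False by (simp add: x_def)
  have "real (n choose s) * x ^ s \<le> exp (real s)"
  proof (cases "s \<le> n")
    case True
    have "real (n choose s) * x ^ s \<le> (\<Sum>k\<le>n. real (n choose k) * x ^ k)"
      using x True by (intro member_le_sum) auto
    also have "\<dots> = (1 + x) ^ n" using binomial_ring[of x 1 n] by (simp add: add.commute)
    also have "\<dots> \<le> exp x ^ n" using x by (intro power_mono) auto
    also have "\<dots> = exp (real s)" using False by (simp add: exp_of_nat_mult[symmetric] x_def)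
    finally show ?thesis .
  qed (simp add: binomial_eq_0)
  then have "real (n choose s) \<le> exp (real s) / x ^ s" using x by (simp add: field_simps)
  also have "\<dots> = (exp 1 * real n / real s) ^ s"
    by (simp add: x_def power_divide power_mult_distrib exp_of_nat_mult[symmetric])
  finally show ?thesis .
qed (use s in \<open>simp add: binomial_eq_0\<close>)

lemma exp_neg_linear_tendsto_0:
  fixes c :: real
  assumes "0 < c"
  shows "(\<lambda>n. exp (- (c * real n))) \<longlonglongrightarrow> 0"
proof -
  have "(\<lambda>n. exp (- c) ^ n) \<longlonglongrightarrow> 0" using assms by (intro LIMSEQ_power_zero) auto
  then show ?thesis by (simp add: exp_of_nat_mult[symmetric] mult.commute)
qed

text \<open>The assumption on \<open>s\<close> gives both \<open>e n / s \<le> m\<close>, hence \<open>n choose s \<le> m ^ s\<close>, and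
  \<open>m s / (2 n) \<ge> 2 (1 + \<eta>) ln m\<close>.\<close>

lemma count_times_no_edge_prob_le:
  fixes \<epsilon> \<eta> :: real
  defines "\<theta> \<equiv> (1 - \<epsilon>) ^ 3 * (1 + \<eta>) / (1 + \<epsilon>)"
  assumes \<epsilon>: "0 < \<epsilon>" "\<epsilon> < 1" and \<eta>: "0 < \<eta>" and \<theta>: "1 < \<theta>"
    and m: "0 < m" "1 \<le> ln (real m)" and n: "0 < n"
    and s: "(1 + \<eta>) * (4 * ln (real m) / real m) * real n \<le> real s"
  shows "real (n choose s) ^ 2 * exp (- (real m * ((1 - \<epsilon>) * real m) * (real s - \<epsilon> * real s)\<^sup>2 /
        (2 * ((1 + \<epsilon>) * (real m * real n))))) \<le> exp (- (2 * (\<theta> - 1) * ((1 + \<eta>) * (4 * ln (real m) / real m)) * real n))"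
proof -
  let ?L = "ln (real m)"
  have "0 < ?L" using m by linarith
  then have "0 < (1 + \<eta>) * (4 * ?L / real m) * real n" using m n \<eta> by (intro mult_pos_pos divide_pos_pos) auto
  then have s0: "0 < real s" using s by linarith
  have key: "4 * (1 + \<eta>) * ?L * real n \<le> real m * real s"
    using s m by (simp add: field_simps)
  \<comment> \<open>Here \<open>ln m \<ge> 1\<close> and \<open>exp 1 \<le> 3\<close> enter, so that
    \<open>key\<close> also yields \<open>exp 1 * n \<le> m * s\<close>.\<close>
  have e4: "exp 1 \<le> 4 * (1 + \<eta>) * ?L"
  proof -
    have "4 * 1 * 1 \<le> 4 * (1 + \<eta>) * ?L" using \<eta> m by (intro mult_mono) auto
    then show ?thesis using exp_le by linarith
  qed
  have "exp 1 * real n \<le> real m * real s"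
    using mult_right_mono[OF e4, of "real n"] key by linarith
  then have "exp 1 * real n / real s \<le> real m" using s0 by (simp add: field_simps)
  then have "(exp 1 * real n / real s) ^ s \<le> real m ^ s" by (intro power_mono) auto
  then have "real (n choose s) \<le> real m ^ s" using binomial_le_exp_power[of s n] s0 by linarith
  also have "real m ^ s = exp (real s * ?L)" using m by (simp add: exp_of_nat_mult)
  finally have "real (n choose s) ^ 2 \<le> exp (real s * ?L) ^ 2" by (intro power_mono) auto
  also have "\<dots> = exp (2 * real s * ?L)" by (simp add: exp_double[symmetric] mult_ac)
  finally have count: "real (n choose s) ^ 2 \<le> exp (2 * real s * ?L)" .
  \<comment> \<open>In \<theta> one factor \<open>1 - \<epsilon>\<close> comes from the block
    length, two come from the squared set size, and the denominator comes from the total weight. The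
    gain over the count of pairs is the excess of \<theta> over 1.\<close>
  have "2 * real s * ?L * \<theta> \<le> (1 - \<epsilon>) ^ 3 / (1 + \<epsilon>) * real s / (2 * real n) * (real m * real s)"
  proof -
    have "2 * real s * ?L * \<theta> = (1 - \<epsilon>) ^ 3 / (1 + \<epsilon>) * real s / (2 * real n) * (4 * (1 + \<eta>) * ?L * real n)"
    proof -
      have "2 * real s * ?L * (c * (1 + \<eta>)) = c * real s / (2 * real n) * (4 * (1 + \<eta>) * ?L * real n)" for c
        using n by (simp add: field_simps)
      from this[of "(1 - \<epsilon>) ^ 3 / (1 + \<epsilon>)"] show ?thesis by (simp add: \<theta>_def)
    qed
    also have "\<dots> \<le> (1 - \<epsilon>) ^ 3 / (1 + \<epsilon>) * real s / (2 * real n) * (real m * real s)"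
      using \<epsilon> by (intro mult_left_mono[OF key]) auto
    finally show ?thesis .
  qed
  also have "\<dots> = real m * ((1 - \<epsilon>) * real m) * (real s - \<epsilon> * real s)\<^sup>2 / (2 * ((1 + \<epsilon>) * (real m * real n)))"
  proof -
    have "real s - \<epsilon> * real s = (1 - \<epsilon>) * real s" by (simp add: algebra_simps)
    then show ?thesis using m by (simp add: power2_eq_square power3_eq_cube mult_ac)
  qed
  finally have expo: "2 * real s * ?L * \<theta> \<le>
    real m * ((1 - \<epsilon>) * real m) * (real s - \<epsilon> * real s)\<^sup>2 / (2 * ((1 + \<epsilon>) * (real m * real n)))" (is "_ \<le> ?X") .
  have "real (n choose s) ^ 2 * exp (- ?X) \<le> exp (2 * real s * ?L) * exp (- (2 * real s * ?L * \<theta>))"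
    using count expo by (intro mult_mono) auto
  also have "\<dots> = exp (- (2 * (\<theta> - 1) * (real s * ?L)))"
    by (simp add: mult_exp_exp algebra_simps)
  also have "\<dots> \<le> exp (- (2 * (\<theta> - 1) * ((1 + \<eta>) * (4 * ?L / real m)) * real n))"
  proof -
    \<comment> \<open>Since \<open>?L \<ge> 1\<close>, the product \<open>real s * ?L\<close> is at
      least \<open>real s\<close>, which is linear in \<open>n\<close> by assumption.\<close>
    have "(1 + \<eta>) * (4 * ?L / real m) * real n \<le> real s * ?L"
      using s mult_left_mono[OF m(2), of "real s"] by simp
    then have "2 * (\<theta> - 1) * ((1 + \<eta>) * (4 * ?L / real m) * real n) \<le> 2 * (\<theta> - 1) * (real s * ?L)"
      using \<theta> by (intro mult_left_mono) auto
    then show ?thesis by (simp add: mult.assoc)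
  qed
  finally show ?thesis .
qed

text \<open>The expression tends to \<open>1 + \<eta>\<close> as \<epsilon> decreases to 0, so
  \<eta> leaves room for all the losses in the Chernoff bounds.\<close>

lemma exists_slack:
  fixes \<eta> :: real
  assumes "0 < \<eta>"
  obtains \<epsilon> :: real where "0 < \<epsilon>" "\<epsilon> < 1" "1 < (1 - \<epsilon>) ^ 3 * (1 + \<eta>) / (1 + \<epsilon>)"
proof -
  have "((\<lambda>\<epsilon>. (1 - \<epsilon>) ^ 3 * (1 + \<eta>) / (1 + \<epsilon>)) \<longlongrightarrow> (1 - 0) ^ 3 * (1 + \<eta>) / (1 + 0)) (at_right 0)"
    by (intro tendsto_intros) auto
  then have "\<forall>\<^sub>F \<epsilon> in at_right 0. 1 < (1 - \<epsilon>) ^ 3 * (1 + \<eta>) / (1 + \<epsilon>)"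
    using assms by (intro order_tendstoD(1)) auto
  moreover have "\<forall>\<^sub>F \<epsilon> in at_right 0. \<epsilon> \<in> {0<..<1::real}"
    by (rule eventually_at_right_real) simp
  ultimately have "\<forall>\<^sub>F \<epsilon> in at_right 0. 0 < \<epsilon> \<and> \<epsilon> < 1 \<and> 1 < (1 - \<epsilon>) ^ 3 * (1 + \<eta>) / (1 + \<epsilon>)"
    by eventually_elim auto
  then have "\<exists>\<epsilon>::real. 0 < \<epsilon> \<and> \<epsilon> < 1 \<and> 1 < (1 - \<epsilon>) ^ 3 * (1 + \<eta>) / (1 + \<epsilon>)"
    by (rule eventually_happens'[OF trivial_limit_at_right_real])
  then show thesis using that by blast
qed

theorem mainTheorem6:
  shows "\<forall>\<eta>>0::real. \<exists>m0::nat. \<forall>m\<ge>m0.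
    (\<lambda>n. measure (br_law m n) {\<omega> \<in> space (br_law m n).
       \<not> (\<exists>A B. A \<subseteq> {1..n} \<and> B \<subseteq> {1..n} \<and> A \<inter> B = {} \<and>
          real (card A) \<ge> (1 + \<eta>) * (4 * ln (real m) / real m) * real n \<and>
          real (card B) \<ge> (1 + \<eta>) * (4 * ln (real m) / real m) * real n \<and>
          \<not> edge_between (br_edges m n \<omega>) A B)}) \<longlonglongrightarrow> 1"
proof (intro allI impI)
  fix \<eta> :: real assume \<eta>: "0 < \<eta>"
  obtain \<epsilon> :: real where \<epsilon>: "0 < \<epsilon>" "\<epsilon> < 1" and \<theta>: "1 < (1 - \<epsilon>) ^ 3 * (1 + \<eta>) / (1 + \<epsilon>)"
    using exists_slack[OF \<eta>] by blast
  define \<theta> where "\<theta> = (1 - \<epsilon>) ^ 3 * (1 + \<eta>) / (1 + \<epsilon>)"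
  have \<epsilon>3: "1 \<le> 1 / \<epsilon> ^ 3" using \<epsilon> by (simp add: power_le_one)
  show "\<exists>m0::nat. \<forall>m\<ge>m0.
    (\<lambda>n. measure (br_law m n) {\<omega> \<in> space (br_law m n).
       \<not> (\<exists>A B. A \<subseteq> {1..n} \<and> B \<subseteq> {1..n} \<and> A \<inter> B = {} \<and>
          real (card A) \<ge> (1 + \<eta>) * (4 * ln (real m) / real m) * real n \<and>
          real (card B) \<ge> (1 + \<eta>) * (4 * ln (real m) / real m) * real n \<and>
          \<not> edge_between (br_edges m n \<omega>) A B)}) \<longlonglongrightarrow> 1"
  \<comment> \<open>This \<open>m0\<close> forces \<open>ln m \<ge> 1 / \<epsilon> ^ 3\<close>,
    which gives both \<open>ln m \<ge> 1\<close> and the size of \<open>s n\<close> that makes many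
    short blocks unlikely.\<close>
  proof (intro exI[of _ "nat \<lceil>exp (1 / \<epsilon> ^ 3)\<rceil>"] allI impI)
    fix m assume "nat \<lceil>exp (1 / \<epsilon> ^ 3)\<rceil> \<le> m"
    then have em: "exp (1 / \<epsilon> ^ 3) \<le> real m" by linarith
    then have m: "0 < m" using exp_gt_zero[of "1 / \<epsilon> ^ 3"] by linarith
    then have lnm: "1 / \<epsilon> ^ 3 \<le> ln (real m)" using em by (simp add: ln_ge_iff)
    then have lnm1: "1 \<le> ln (real m)" using \<epsilon>3 by linarith
    define a where "a = (1 + \<eta>) * (4 * ln (real m) / real m)"
    have "0 < ln (real m)" using lnm1 by linarith
    then have a: "0 < a" unfolding a_def using \<eta> m by (intro mult_pos_pos divide_pos_pos) auto
    \<comment> \<open>Rounding up changes no event: a cardinality reaches \<open>a * real n\<close>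
      exactly when it reaches \<open>s n\<close>.\<close>
    define s where "s n = nat \<lceil>a * real n\<rceil>" for n
    have s_iff: "a * real n \<le> real c \<longleftrightarrow> s n \<le> c" for n c
      by (auto simp: s_def nat_le_iff ceiling_le_iff)
    have s_ge: "a * real n \<le> real (s n)" for n using s_iff by blast
    define X where "X n = {\<omega> \<in> space (br_law m n). \<exists>A B. A \<subseteq> {1..n} \<and> B \<subseteq> {1..n} \<and> A \<inter> B = {} \<and>
      s n \<le> card A \<and> s n \<le> card B \<and> \<not> edge_between (br_edges m n \<omega>) A B}" for n
    define g where "g n = exp 1 * exp (- (\<epsilon>\<^sup>2 / 8 * real m * real n)) + exp (- ((1 - ln 2) * real n)) +
      exp (- (2 * (\<theta> - 1) * a * real n))" for n
    have X_le: "measure (br_law m n) (X n) \<le> g n" if n: "0 < n" for n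
    proof -
      have "real n \<le> \<epsilon>\<^sup>2 / 4 * (real m * (\<epsilon> * real (s n)))"
      proof -
        \<comment> \<open>The denominator of \<open>a\<close> cancels \<open>m\<close>, leaving
          \<open>(1 + \<eta>) * \<epsilon> ^ 3 * ln m\<close> times \<open>n\<close>, which is at
          least \<open>n\<close> by the choice of \<open>m0\<close>.\<close>
        have "1 \<le> \<epsilon> ^ 3 * ln (real m)" using lnm \<epsilon> by (simp add: field_simps)
        also have "\<dots> \<le> (1 + \<eta>) * (\<epsilon> ^ 3 * ln (real m))"
          using \<eta> \<epsilon> lnm1 by simp
        finally have "real n \<le> (1 + \<eta>) * (\<epsilon> ^ 3 * ln (real m)) * real n" using n by simp
        also have "\<dots> = \<epsilon> ^ 3 / 4 * real m * (a * real n)" using m by (simp add: a_def)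
        also have "\<dots> \<le> \<epsilon> ^ 3 / 4 * real m * real (s n)"
          using \<epsilon> by (intro mult_left_mono s_ge) auto
        finally show ?thesis by (simp add: power2_eq_square power3_eq_cube mult_ac)
      qed
      then have "emeasure (br_law m n) (X n) \<le> ennreal (exp (1 - \<epsilon>\<^sup>2 / 8 * (real m * real n)) + 2 ^ n * exp (- real n) +
        real (n choose s n) ^ 2 * exp (- (real m * ((1 - \<epsilon>) * real m) * (real (s n) - \<epsilon> * real (s n))\<^sup>2 /
          (2 * ((1 + \<epsilon>) * (real m * real n))))))"
        unfolding X_def using \<epsilon> m by (intro emeasure_br_law_no_edge_pair_le) auto
      also have "\<dots> \<le> ennreal (g n)"
      proof (rule ennreal_leI)
        have "2 ^ n * exp (- real n) = exp (- ((1 - ln 2) * real n))"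
        proof -
          have "2 ^ n = exp (real n * ln 2)" by (simp add: exp_of_nat_mult)
          then show ?thesis by (simp add: mult_exp_exp algebra_simps)
        qed
        moreover have "exp (1 - \<epsilon>\<^sup>2 / 8 * (real m * real n)) = exp 1 * exp (- (\<epsilon>\<^sup>2 / 8 * real m * real n))"
          by (simp add: mult_exp_exp mult.assoc)
        ultimately show "exp (1 - \<epsilon>\<^sup>2 / 8 * (real m * real n)) + 2 ^ n * exp (- real n) +
          real (n choose s n) ^ 2 * exp (- (real m * ((1 - \<epsilon>) * real m) * (real (s n) - \<epsilon> * real (s n))\<^sup>2 /
            (2 * ((1 + \<epsilon>) * (real m * real n))))) \<le> g n"
          using count_times_no_edge_prob_le[OF \<epsilon> \<eta> \<theta> m lnm1 n s_ge[unfolded a_def]]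
          by (simp add: g_def \<theta>_def a_def)
      qed
      finally have "emeasure (br_law m n) (X n) \<le> ennreal (g n)" .
      moreover have "0 \<le> g n" unfolding g_def by (intro add_nonneg_nonneg mult_nonneg_nonneg) auto
      ultimately show ?thesis
        by (simp add: measure_def enn2real_leI)
    qed
    \<comment> \<open>All three decay rates are positive for fixed \<open>m\<close>; the last two
      rest on \<open>ln 2 < 1\<close> and on \<open>\<theta> > 1\<close> with
      \<open>a > 0\<close>.\<close>
    have "g \<longlonglongrightarrow> exp 1 * 0 + 0 + 0"
      unfolding g_def using \<epsilon> m a \<theta>[folded \<theta>_def] ln_2_less_1
      by (intro tendsto_add tendsto_mult tendsto_const exp_neg_linear_tendsto_0) auto
    then have "g \<longlonglongrightarrow> 0" by simp
    then have "(\<lambda>n. measure (br_law m n) (X n)) \<longlonglongrightarrow> 0"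
      by (rule tendsto_sandwich[OF _ _ tendsto_const, rotated 2])
         (auto intro!: eventually_sequentiallyI[of 1] X_le)
    then have "(\<lambda>n. 1 - measure (br_law m n) (X n)) \<longlonglongrightarrow> 1 - 0"
      by (intro tendsto_diff tendsto_const)
    also have "(\<lambda>n. 1 - measure (br_law m n) (X n)) = (\<lambda>n. measure (br_law m n) {\<omega> \<in> space (br_law m n).
       \<not> (\<exists>A B. A \<subseteq> {1..n} \<and> B \<subseteq> {1..n} \<and> A \<inter> B = {} \<and>
          real (card A) \<ge> (1 + \<eta>) * (4 * ln (real m) / real m) * real n \<and>
          real (card B) \<ge> (1 + \<eta>) * (4 * ln (real m) / real m) * real n \<and>
          \<not> edge_between (br_edges m n \<omega>) A B)})"
    proof
      fix n
      interpret prob_space "br_law m n" by (rule prob_space_br_law)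
      have "X n \<in> sets (br_law m n)" unfolding X_def sets_br_law by (rule no_edge_pair_sets)
      then have "1 - measure (br_law m n) (X n) = measure (br_law m n) (space (br_law m n) - X n)"
        by (rule prob_compl[symmetric])
      also have "space (br_law m n) - X n = {\<omega> \<in> space (br_law m n).
       \<not> (\<exists>A B. A \<subseteq> {1..n} \<and> B \<subseteq> {1..n} \<and> A \<inter> B = {} \<and> s n \<le> card A \<and> s n \<le> card B \<and>
          \<not> edge_between (br_edges m n \<omega>) A B)}"
        unfolding X_def by blast
      finally show "1 - measure (br_law m n) (X n) = measure (br_law m n) {\<omega> \<in> space (br_law m n).
       \<not> (\<exists>A B. A \<subseteq> {1..n} \<and> B \<subseteq> {1..n} \<and> A \<inter> B = {} \<and>
          real (card A) \<ge> (1 + \<eta>) * (4 * ln (real m) / real m) * real n \<and>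
          real (card B) \<ge> (1 + \<eta>) * (4 * ln (real m) / real m) * real n \<and>
          \<not> edge_between (br_edges m n \<omega>) A B)}"
        \<comment> \<open>Both real thresholds turn into conditions on \<open>s n\<close>, which
          matches the complement of \<open>X n\<close>.\<close>
        unfolding a_def[symmetric] s_iff .
    qed
    finally show "(\<lambda>n. measure (br_law m n) {\<omega> \<in> space (br_law m n).
       \<not> (\<exists>A B. A \<subseteq> {1..n} \<and> B \<subseteq> {1..n} \<and> A \<inter> B = {} \<and>
          real (card A) \<ge> (1 + \<eta>) * (4 * ln (real m) / real m) * real n \<and>
          real (card B) \<ge> (1 + \<eta>) * (4 * ln (real m) / real m) * real n \<and>
          \<not> edge_between (br_edges m n \<omega>) A B)}) \<longlonglongrightarrow> 1" by simp
  qed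
qed

end
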